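(* Let $f(x)=\sum_{i\in\mathbb Z}f_ix^i$ be a function analytic in the open annulus $\mathbb A(r_f,R_f)=\{x\in\mathbb C: r_f<|x|<R_f\}$, $r_f<R_f$. Let $a(z)\in\mathcal W_1$ and consider a matrix $A=T(a)+E_a\in\mathcal{CQT}$. If $a(\mathbb T)\subset\mathbb A(r_f,R_f)$, $A$ is invertible with $A^{-1}\in\mathcal{CQT}$ and $\|A^{-1}\|_{\mathcal{CQT}}<r_f^{-1}$, and $\|A\|_{\mathcal{CQT}}<R_f$, then \[ f(A):=\sum_{i\in\mathbb Z}f_iA^i=T(f(a))+E_{f(a)}\in\mathcal{CQT}, \] where $f(a)$ denotes the function $z\mapsto f(a(z))$ and $E_{f(a)}\in\mathcal F$. Moreover, if $A\in\mathcal{AQT}$ then $f(A)\in\mathcal{AQT}$.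
   Context: $\mathbb T=\{z\in\mathbb C:|z|=1\}$; $\mathbb Z^+$ is the set of positive integers. The Wiener class $\mathcal W$ is the set of complex Laurent series $a(z)=\sum_{i\in\mathbb Z}a_iz^i$ (viewed as functions on $\mathbb T$) with $\|a\|_{\mathcal W}:=\sum_{i\in\mathbb Z}|a_i|<\infty$. $\mathcal W_1:=\{a\in\mathcal W: a'\in\mathcal W\}$, where $a'(z)=\sum_{i} i a_i z^{i-1}$, so $\|a'\|_{\mathcal W}=\sum_i|i a_i|$. For $a\in\mathcal W$, $T(a)=(t_{i,j})_{i,j\in\mathbb Z^+}$ is the semi-infinite Toeplitz matrix with $t_{i,j}=a_{j-i}$. $\mathcal F$ is the set of semi-infinite complex matrices $F=(f_{i,j})_{i,j\in\mathbb Z^+}$ with $\|F\|_{\mathcal F}:=\sum_{i,j}|f_{i,j}|<\infty$. $\mathcal{CQT}$ is the set of matrices $T(a)+E$ with $a\in\mathcal W_1$ and $E\in\mathcal F$, with norm $\|T(a)+E\|_{\mathcal{CQT}}:=\|a\|_{\mathcal W}+\|a'\|_{\mathcal W}+\|E\|_{\mathcal F}$; it is known to be a Banach algebra with submultiplicative norm. $\mathcal{AQT}$ is the set of matrices $T(a)+E$ with $E\in\mathcal F$ and $a(z)$ analytic in an open annulus containing $\mathbb T$. The sum $\sum_{i\in\mathbb Z}f_iA^i$ is the limit in $\|\cdot\|_{\mathcal{CQT}}$ of $\sum_{i=-k}^kf_iA^i$ as $k\to\infty$, with $A^{-i}=(A^{-1})^i$ and $A^0=I$. If $r_f=0$, $r_f^{-1}$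 is read as $+\infty$. *)

theory Defs
  imports "HOL-Complex_Analysis.Complex_Analysis"
begin

text \<open>Open annuli centred at the origin. The outer radius may be \<open>\<infinity>\<close>; the inner radius is
  meant to be nonnegative.\<close>

definition annulus :: "ereal \<Rightarrow> ereal \<Rightarrow> complex set" where
  "annulus r R = {x. r < ereal (norm x) \<and> ereal (norm x) < R}"

definition analytic_laurent :: "(complex \<Rightarrow> complex) \<Rightarrow> (int \<Rightarrow> complex) \<Rightarrow> ereal \<Rightarrow> ereal \<Rightarrow> bool" where
  "analytic_laurent f c r R \<longleftrightarrow>
     f analytic_on annulus r R \<and>
     (\<forall>x\<in>annulus r R. ((\<lambda>i. c i * x powi i) has_sum f x) UNIV)"


text \<open>A Laurent series is given by its coefficient family; \<open>symbol a\<close> is the function it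
  represents, to be used only where the series converges absolutely.\<close>

definition symbol :: "(int \<Rightarrow> complex) \<Rightarrow> complex \<Rightarrow> complex" where
  "symbol a z = (\<Sum>\<^sub>\<infinity>i. a i * z powi i)"

definition wiener :: "(int \<Rightarrow> complex) set" where
  "wiener = {a. (\<lambda>i. norm (a i)) summable_on UNIV}"

definition wiener_norm :: "(int \<Rightarrow> complex) \<Rightarrow> real" where
  "wiener_norm a = (\<Sum>\<^sub>\<infinity>i. norm (a i))"

text \<open>The formal derivative \<open>\<Sum>i. i a\<^sub>i z\<^sup>i\<^sup>-\<^sup>1\<close>, as a coefficient family.\<close>

definition laurent_deriv :: "(int \<Rightarrow> complex) \<Rightarrow> int \<Rightarrow> complex" where
  "laurent_deriv a = (\<lambda>i. of_int (i + 1) * a (i + 1))"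

definition wiener1 :: "(int \<Rightarrow> complex) set" where
  "wiener1 = {a \<in> wiener. laurent_deriv a \<in> wiener}"


text \<open>Semi-infinite matrices are indexed from \<open>0\<close> instead of \<open>1\<close>; Toeplitz matrices and all
  the notions below are insensitive to this shift.\<close>

type_synonym smat = "nat \<Rightarrow> nat \<Rightarrow> complex"

definition toeplitz :: "(int \<Rightarrow> complex) \<Rightarrow> smat" where
  "toeplitz a = (\<lambda>i j. a (int j - int i))"

definition smat_add :: "smat \<Rightarrow> smat \<Rightarrow> smat" where
  "smat_add M N = (\<lambda>i j. M i j + N i j)"

definition smat_diff :: "smat \<Rightarrow> smat \<Rightarrow> smat" where
  "smat_diff M N = (\<lambda>i j. M i j - N i j)"

definition smat_one :: smat where
  "smat_one = (\<lambda>i j. if i = j then 1 else 0)"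

definition smat_mult :: "smat \<Rightarrow> smat \<Rightarrow> smat" where
  "smat_mult M N = (\<lambda>i j. \<Sum>\<^sub>\<infinity>k. M i k * N k j)"

primrec smat_power :: "smat \<Rightarrow> nat \<Rightarrow> smat" where
  "smat_power M 0 = smat_one"
| "smat_power M (Suc n) = smat_mult M (smat_power M n)"

definition Fset :: "smat set" where
  "Fset = {E. (\<lambda>(i, j). norm (E i j)) summable_on UNIV}"

definition Fnorm :: "smat \<Rightarrow> real" where
  "Fnorm E = (\<Sum>\<^sub>\<infinity>(i, j). norm (E i j))"

definition CQT :: "smat set" where
  "CQT = {smat_add (toeplitz a) E | a E. a \<in> wiener1 \<and> E \<in> Fset}"

definition AQT :: "smat set" where
  "AQT = {smat_add (toeplitz a) E | a E.
            E \<in> Fset \<and> (\<exists>h r R. 0 \<le> r \<and> r < 1 \<and> 1 < R \<and> analytic_laurent h a r R)}"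

lemma toeplitz_add_unique:
  assumes "smat_add (toeplitz a) E = smat_add (toeplitz b) E'" and "E \<in> Fset" and "E' \<in> Fset"
  shows "a = b" and "E = E'"
proof -
  show ab: "a = b"
  proof
    fix k :: int
    define p where "p = (\<lambda>n. (nat (max 0 (- k)) + n, nat (max 0 k) + n))"
    have inj: "inj p" by (auto simp: inj_on_def p_def)
    have lim: "(\<lambda>n. norm (D (fst (p n)) (snd (p n)))) \<longlonglongrightarrow> 0" if "D \<in> Fset" for D
    proof -
      have "(\<lambda>(i, j). norm (D i j)) summable_on range p"
        using that summable_on_subset_banach unfolding Fset_def by blast
      hence "((\<lambda>(i, j). norm (D i j)) \<circ> p) summable_on UNIV"
        using summable_on_reindex[OF inj] by blast
      hence "summable ((\<lambda>(i, j). norm (D i j)) \<circ> p)"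
        by (rule summable_on_imp_summable)
      thus ?thesis
        by (auto dest!: summable_LIMSEQ_zero simp: o_def case_prod_beta)
    qed
    have eq: "a k - b k = E' (fst (p n)) (snd (p n)) - E (fst (p n)) (snd (p n))" for n
    proof -
      have "int (snd (p n)) - int (fst (p n)) = k" by (auto simp: p_def)
      thus ?thesis
        using fun_cong[OF fun_cong[OF assms(1)], of "fst (p n)" "snd (p n)"]
        by (simp add: smat_add_def toeplitz_def algebra_simps)
    qed
    have "(\<lambda>n. E' (fst (p n)) (snd (p n)) - E (fst (p n)) (snd (p n))) \<longlonglongrightarrow> 0 - 0"
      by (rule tendsto_diff[OF tendsto_norm_zero_cancel[OF lim[OF assms(3)]]
            tendsto_norm_zero_cancel[OF lim[OF assms(2)]]])
    hence "(\<lambda>n. a k - b k) \<longlonglongrightarrow> 0" by (simp add: eq[symmetric])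
    thus "a k = b k" by (simp add: LIMSEQ_const_iff)
  qed
  show "E = E'"
    using assms(1) by (simp add: ab smat_add_def fun_eq_iff)
qed

text \<open>The decomposition \<open>T(a) + E\<close> is unique by \<open>toeplitz_add_unique\<close>, so the norm is
  well defined on \<open>CQT\<close>.\<close>

definition cqt_norm :: "smat \<Rightarrow> real" where
  "cqt_norm M = (THE x. \<exists>a E. a \<in> wiener1 \<and> E \<in> Fset \<and> M = smat_add (toeplitz a) E \<and>
     x = wiener_norm a + wiener_norm (laurent_deriv a) + Fnorm E)"

lemma cqt_norm_eq:
  assumes "a \<in> wiener1" and "E \<in> Fset"
  shows "cqt_norm (smat_add (toeplitz a) E) =
           wiener_norm a + wiener_norm (laurent_deriv a) + Fnorm E"
  unfolding cqt_norm_def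
proof (rule the_equality)
  fix x
  assume "\<exists>b E'. b \<in> wiener1 \<and> E' \<in> Fset \<and>
      smat_add (toeplitz a) E = smat_add (toeplitz b) E' \<and>
      x = wiener_norm b + wiener_norm (laurent_deriv b) + Fnorm E'"
  then obtain b E' where b: "E' \<in> Fset" "smat_add (toeplitz a) E = smat_add (toeplitz b) E'"
      "x = wiener_norm b + wiener_norm (laurent_deriv b) + Fnorm E'"
    by blast
  have "a = b" "E = E'"
    using toeplitz_add_unique[OF b(2) assms(2) b(1)] by simp_all
  with b(3) show "x = wiener_norm a + wiener_norm (laurent_deriv a) + Fnorm E"
    by simp
qed (use assms in blast)

definition is_cqt_inverse :: "smat \<Rightarrow> smat \<Rightarrow> bool" where
  "is_cqt_inverse A B \<longleftrightarrow> B \<in> CQT \<and> smat_mult A B = smat_one \<and> smat_mult B A = smat_one"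

definition cqt_tendsto :: "(nat \<Rightarrow> smat) \<Rightarrow> smat \<Rightarrow> bool" where
  "cqt_tendsto X M \<longleftrightarrow>
     (\<forall>k. X k \<in> CQT) \<and> M \<in> CQT \<and> (\<lambda>k. cqt_norm (smat_diff (X k) M)) \<longlonglongrightarrow> 0"

text \<open>Integer powers of \<open>A\<close>, where \<open>B\<close> is the inverse of \<open>A\<close>.\<close>

definition smat_powi :: "smat \<Rightarrow> smat \<Rightarrow> int \<Rightarrow> smat" where
  "smat_powi A B i = (if 0 \<le> i then smat_power A (nat i) else smat_power B (nat (- i)))"

definition laurent_partial_sum :: "(int \<Rightarrow> complex) \<Rightarrow> smat \<Rightarrow> smat \<Rightarrow> nat \<Rightarrow> smat" where
  "laurent_partial_sum c A B k =
     (\<lambda>p q. \<Sum>i = - int k..int k. c i * smat_powi A B i p q)"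

end

theory Submission
  imports Defs
begin

text \<open>For a weight \<open>w\<close> on the integers with \<open>w (i + j) \<le> w i * w j\<close>, the sequences with
  \<open>\<Sum> w i * norm (a i) < \<infinity>\<close> form a Banach algebra under convolution: \<open>w = 1\<close> gives the Wiener
  class, \<open>w i = 1 + \<bar>i\<bar>\<close> gives \<open>W\<^sub>1\<close> with its norm, and \<open>w i = \<rho> ^ \<bar>i\<bar>\<close> with \<open>\<rho> > 1\<close> gives symbols
  analytic near the unit circle. Since \<open>T(a) T(b) - T(ab)\<close> is a product of two summable Hankel
  matrices, the \<open>CQT\<close> norm is submultiplicative, so \<open>A\<^sup>i = T(a\<^sup>i) + E\<^sub>i\<close> with
  \<open>\<parallel>a\<^sup>i\<parallel> + \<parallel>E\<^sub>i\<parallel>\<close> at most the \<open>\<bar>i\<bar>\<close>-th power of the norm of \<open>A\<close> or of its inverse. The hypotheses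
  make \<open>\<Sum> f\<^sub>i a\<^sup>i\<close> and \<open>\<Sum> f\<^sub>i E\<^sub>i\<close> absolutely convergent.

  If \<open>a\<close> is analytic near the circle, then so is its inverse, and as \<open>\<rho>\<close> decreases to \<open>1\<close> the
  \<open>\<rho>\<close>-norms of both decrease to their Wiener norms, which the \<open>CQT\<close> norms dominate. For \<open>\<rho>\<close>
  close to \<open>1\<close> the series \<open>\<Sum> f\<^sub>i a\<^sup>i\<close> therefore also converges in the \<open>\<rho>\<close>-norm.\<close>

no_notation Infinite_Set_Sum.abs_summable_on (infix "abs'_summable'_on" 50)

section \<open>Weighted summable families\<close>

text \<open>The index type is left open so that the same lemmas serve symbols, indexed by integers,
  and correction matrices, read through \<open>case_prod\<close> as families over index
  pairs.\<close>

definition wl1 :: "('x \<Rightarrow> real) \<Rightarrow> ('x \<Rightarrow> complex) set" where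
  "wl1 w = {a. (\<lambda>i. w i * norm (a i)) summable_on UNIV}"

text \<open>Outside \<open>wl1 w\<close> the infinite sum takes the default value 0, so a norm bound
  carries information only together with membership.\<close>

definition wl1_norm :: "('x \<Rightarrow> real) \<Rightarrow> ('x \<Rightarrow> complex) \<Rightarrow> real" where
  "wl1_norm w a = (\<Sum>\<^sub>\<infinity>i. w i * norm (a i))"

text \<open>Tonelli and Fubini: the summable bounds \<open>B\<close> make the double family
  absolutely summable, so the triangle inequality applies inside the sum and the two orders of
  summation agree.\<close>

lemma abs_summable_family:
  fixes u :: "'n \<Rightarrow> 'x \<Rightarrow> complex"
  assumes "\<And>n. n \<in> N \<Longrightarrow> u n abs_summable_on UNIV"
    and "\<And>n. n \<in> N \<Longrightarrow> (\<Sum>\<^sub>\<infinity>x. norm (u n x)) \<le> B n"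
    and B: "B summable_on N"
  shows "(\<lambda>(n, x). u n x) abs_summable_on (N \<times> UNIV)"
    and "(\<lambda>n. u n x) abs_summable_on N"
    and "(\<lambda>x. \<Sum>\<^sub>\<infinity>n\<in>N. u n x) abs_summable_on UNIV"
    and "(\<Sum>\<^sub>\<infinity>x. norm (\<Sum>\<^sub>\<infinity>n\<in>N. u n x)) \<le> infsum B N"
    and "(\<Sum>\<^sub>\<infinity>x. \<Sum>\<^sub>\<infinity>n\<in>N. u n x) = (\<Sum>\<^sub>\<infinity>n\<in>N. \<Sum>\<^sub>\<infinity>x. u n x)"
proof -
  have S: "(\<lambda>n. \<Sum>\<^sub>\<infinity>x. norm (u n x)) summable_on N"
    by (rule summable_on_comparison_test[OF B]) (use assms in \<open>auto intro: infsum_nonneg\<close>)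
  show J: "(\<lambda>(n, x). u n x) abs_summable_on (N \<times> UNIV)"
    by (subst Infinite_Sum.abs_summable_on_Sigma_iff) (use assms(1) S in \<open>auto simp: infsum_nonneg\<close>)
  have J': "(\<lambda>(x, n). u n x) abs_summable_on (UNIV \<times> N)"
    using J summable_on_swap[of "\<lambda>(n, x). norm (u n x)" N UNIV] by (simp add: case_prod_unfold)
  show K: "(\<lambda>n. u n x) abs_summable_on N" for x
    using J' by (auto simp: Infinite_Sum.abs_summable_on_Sigma_iff)
  have L: "(\<lambda>x. \<Sum>\<^sub>\<infinity>n\<in>N. norm (u n x)) summable_on UNIV"
    using J' by (auto simp: Infinite_Sum.abs_summable_on_Sigma_iff infsum_nonneg)
  have le: "norm (\<Sum>\<^sub>\<infinity>n\<in>N. u n x) \<le> (\<Sum>\<^sub>\<infinity>n\<in>N. norm (u n x))" for x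
    by (rule norm_infsum_bound[OF K])
  show M: "(\<lambda>x. \<Sum>\<^sub>\<infinity>n\<in>N. u n x) abs_summable_on UNIV"
    by (rule summable_on_comparison_test[OF L]) (use le in auto)
  have "(\<Sum>\<^sub>\<infinity>x. norm (\<Sum>\<^sub>\<infinity>n\<in>N. u n x)) \<le> (\<Sum>\<^sub>\<infinity>x. \<Sum>\<^sub>\<infinity>n\<in>N. norm (u n x))"
    by (rule infsum_mono[OF M L le])
  also have "\<dots> = (\<Sum>\<^sub>\<infinity>n\<in>N. \<Sum>\<^sub>\<infinity>x. norm (u n x))"
    by (rule infsum_swap_banach) (use J' in \<open>simp add: case_prod_unfold\<close>)
  also have "\<dots> \<le> infsum B N"
    by (rule infsum_mono[OF S B]) (use assms in auto)
  finally show "(\<Sum>\<^sub>\<infinity>x. norm (\<Sum>\<^sub>\<infinity>n\<in>N. u n x)) \<le> infsum B N" .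
  show "(\<Sum>\<^sub>\<infinity>x. \<Sum>\<^sub>\<infinity>n\<in>N. u n x) = (\<Sum>\<^sub>\<infinity>n\<in>N. \<Sum>\<^sub>\<infinity>x. u n x)"
    by (rule infsum_swap_banach) (rule abs_summable_summable[OF J'])
qed

text \<open>Completeness in the form needed later: a series dominated in norm can be summed
  coefficientwise without leaving \<open>wl1 w\<close>. Multiplying the terms by the weight reduces
  this to the unweighted case.\<close>

lemma wl1_family:
  fixes u :: "'n \<Rightarrow> 'x \<Rightarrow> complex"
  assumes w: "\<And>i. 0 \<le> w i"
    and "\<And>n. n \<in> N \<Longrightarrow> u n \<in> wl1 w"
    and "\<And>n. n \<in> N \<Longrightarrow> wl1_norm w (u n) \<le> B n"
    and "B summable_on N"
  shows "(\<lambda>i. \<Sum>\<^sub>\<infinity>n\<in>N. u n i) \<in> wl1 w"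
    and "wl1_norm w (\<lambda>i. \<Sum>\<^sub>\<infinity>n\<in>N. u n i) \<le> infsum B N"
proof -
  have 1: "(\<lambda>i. of_real (w i) * u n i) abs_summable_on UNIV" if "n \<in> N" for n
    using assms(2)[OF that] w by (simp add: wl1_def norm_mult)
  have 2: "(\<Sum>\<^sub>\<infinity>i. norm (of_real (w i) * u n i)) \<le> B n" if "n \<in> N" for n
    using assms(3)[OF that] w by (simp add: wl1_norm_def norm_mult)
  have eq: "norm (\<Sum>\<^sub>\<infinity>n\<in>N. of_real (w i) * u n i) = w i * norm (\<Sum>\<^sub>\<infinity>n\<in>N. u n i)" for i
    by (simp add: infsum_cmult_right' norm_mult w)
  show "(\<lambda>i. \<Sum>\<^sub>\<infinity>n\<in>N. u n i) \<in> wl1 w"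
    using abs_summable_family(3)[OF 1 2 assms(4)] by (simp add: wl1_def eq)
  show "wl1_norm w (\<lambda>i. \<Sum>\<^sub>\<infinity>n\<in>N. u n i) \<le> infsum B N"
    using abs_summable_family(4)[OF 1 2 assms(4)] by (simp add: wl1_norm_def eq)
qed

lemma wl1_norm_nonneg: "(\<And>i. 0 \<le> w i) \<Longrightarrow> 0 \<le> wl1_norm w a"
  unfolding wl1_norm_def by (intro infsum_nonneg) simp

lemma wl1_cmult:
  assumes "a \<in> wl1 w"
  shows "(\<lambda>i. c * a i) \<in> wl1 w" and "wl1_norm w (\<lambda>i. c * a i) = norm c * wl1_norm w a"
proof -
  have eq: "w i * norm (c * a i) = norm c * (w i * norm (a i))" for i
    by (simp add: norm_mult)
  show "(\<lambda>i. c * a i) \<in> wl1 w"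
    using assms by (simp add: wl1_def eq summable_on_cmult_right)
  show "wl1_norm w (\<lambda>i. c * a i) = norm c * wl1_norm w a"
    unfolding wl1_norm_def eq by (rule infsum_cmult_right')
qed

lemma wl1_add:
  assumes w: "\<And>i. 0 \<le> w i" and a: "a \<in> wl1 w" and b: "b \<in> wl1 w"
  shows "(\<lambda>i. a i + b i) \<in> wl1 w"
    and "wl1_norm w (\<lambda>i. a i + b i) \<le> wl1_norm w a + wl1_norm w b"
proof -
  have s: "(\<lambda>i. w i * norm (a i) + w i * norm (b i)) summable_on UNIV"
    using a b by (intro summable_on_add) (auto simp: wl1_def)
  have le: "w i * norm (a i + b i) \<le> w i * norm (a i) + w i * norm (b i)" for i
    using w[of i] by (metis distrib_left mult_left_mono norm_triangle_ineq)
  show m: "(\<lambda>i. a i + b i) \<in> wl1 w"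
    unfolding wl1_def mem_Collect_eq
    by (rule summable_on_comparison_test[OF s]) (use le w in auto)
  have "wl1_norm w (\<lambda>i. a i + b i) \<le> (\<Sum>\<^sub>\<infinity>i. w i * norm (a i) + w i * norm (b i))"
    unfolding wl1_norm_def by (rule infsum_mono[OF _ s le]) (use m in \<open>simp add: wl1_def\<close>)
  also have "\<dots> = wl1_norm w a + wl1_norm w b"
    unfolding wl1_norm_def by (rule infsum_add) (use a b in \<open>auto simp: wl1_def\<close>)
  finally show "wl1_norm w (\<lambda>i. a i + b i) \<le> wl1_norm w a + wl1_norm w b" .
qed

lemma wl1_minus: "a \<in> wl1 w \<Longrightarrow> (\<lambda>i. - a i) \<in> wl1 w" "wl1_norm w (\<lambda>i. - a i) = wl1_norm w a"
  by (simp_all add: wl1_def wl1_norm_def)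

lemma wl1_diff:
  assumes w: "\<And>i. 0 \<le> w i" and a: "a \<in> wl1 w" and b: "b \<in> wl1 w"
  shows "(\<lambda>i. a i - b i) \<in> wl1 w"
    and "wl1_norm w (\<lambda>i. a i - b i) \<le> wl1_norm w a + wl1_norm w b"
  using wl1_add[OF w a wl1_minus(1)[OF b]] by (simp_all add: wl1_minus(2))

lemma wl1_mono:
  assumes "a \<in> wl1 w" and "\<And>i. 0 \<le> v i" and "\<And>i. v i \<le> w i"
  shows "a \<in> wl1 v" and "wl1_norm v a \<le> wl1_norm w a"
proof -
  have s: "(\<lambda>i. w i * norm (a i)) summable_on UNIV" using assms(1) by (simp add: wl1_def)
  have le: "v i * norm (a i) \<le> w i * norm (a i)" for i
    using assms(3) by (rule mult_right_mono) simp
  show m: "a \<in> wl1 v"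
    unfolding wl1_def mem_Collect_eq
    by (rule summable_on_comparison_test[OF s]) (use assms(2) le in auto)
  show "wl1_norm v a \<le> wl1_norm w a"
    unfolding wl1_norm_def
    by (rule infsum_mono[OF _ s le]) (use m in \<open>simp add: wl1_def\<close>)
qed

lemma wl1_finite_support:
  assumes "finite {i. a i \<noteq> 0}"
  shows "a \<in> wl1 w"
  unfolding wl1_def mem_Collect_eq
  by (rule finite_nonzero_values_imp_summable_on) (rule finite_subset[OF _ assms], auto)

section \<open>Convolution\<close>

definition conv :: "(int \<Rightarrow> complex) \<Rightarrow> (int \<Rightarrow> complex) \<Rightarrow> int \<Rightarrow> complex" where
  "conv a b i = (\<Sum>\<^sub>\<infinity>k. a k * b (i - k))"

definition delta0 :: "int \<Rightarrow> complex" where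
  "delta0 i = (if i = 0 then 1 else 0)"

primrec conv_power :: "(int \<Rightarrow> complex) \<Rightarrow> nat \<Rightarrow> int \<Rightarrow> complex" where
  "conv_power a 0 = delta0"
| "conv_power a (Suc n) = conv a (conv_power a n)"

lemma bij_shift: "bij (\<lambda>i::int. i - k)" "bij (\<lambda>i::int. i + k)"
  by (rule bij_betw_byWitness[where f' = "\<lambda>i. i + k"], auto)
     (rule bij_betw_byWitness[where f' = "\<lambda>i. i - k"], auto)

text \<open>The convolution is the series of the shifts of \<open>b\<close> with coefficients
  \<open>a k\<close>, and \<open>B k\<close> bounds the norm of the shift by \<open>k\<close>.
  Keeping \<open>B\<close> free allows both the submultiplicative bound and the finer one in
  \<open>conv_wder\<close>.\<close>

lemma wl1_conv:
  assumes w: "\<And>i. 0 \<le> w i"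
    and b: "\<And>k. (\<lambda>j. w (j + k) * norm (b j)) summable_on UNIV"
    and le: "\<And>k. (\<Sum>\<^sub>\<infinity>j. w (j + k) * norm (b j)) \<le> B k"
    and B: "(\<lambda>k. norm (a k) * B k) summable_on UNIV"
  shows "conv a b \<in> wl1 w" and "wl1_norm w (conv a b) \<le> (\<Sum>\<^sub>\<infinity>k. norm (a k) * B k)"
proof -
  define u where "u = (\<lambda>k i. a k * b (i - k))"
  have eq: "w i * norm (u k i) = norm (a k) * (w ((i - k) + k) * norm (b (i - k)))" for k i
    by (simp add: u_def norm_mult)
  have sh: "(\<lambda>i. w ((i - k) + k) * norm (b (i - k))) summable_on UNIV"
    "(\<Sum>\<^sub>\<infinity>i. w ((i - k) + k) * norm (b (i - k))) = (\<Sum>\<^sub>\<infinity>j. w (j + k) * norm (b j))" for k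
    using b[of k] summable_on_reindex_bij_betw[OF bij_shift(1), of "\<lambda>j. w (j + k) * norm (b j)" k]
      infsum_reindex_bij_betw[OF bij_shift(1), of "\<lambda>j. w (j + k) * norm (b j)" k] by auto
  have 1: "u k \<in> wl1 w" for k
    unfolding wl1_def eq mem_Collect_eq by (rule summable_on_cmult_right[OF sh(1)])
  have 2: "wl1_norm w (u k) \<le> norm (a k) * B k" for k
    unfolding wl1_norm_def eq infsum_cmult_right' sh(2) by (rule mult_left_mono[OF le]) simp
  show "conv a b \<in> wl1 w" and "wl1_norm w (conv a b) \<le> (\<Sum>\<^sub>\<infinity>k. norm (a k) * B k)"
    using wl1_family[OF w 1 2 B] unfolding u_def conv_def[abs_def] by auto
qed

text \<open>Submultiplicativity gives closure under convolution, \<open>w 0 = 1\<close> gives the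
  unit norm one, and \<open>1 \<le> w i\<close> embeds the space into the Wiener class.\<close>

locale weight =
  fixes w :: "int \<Rightarrow> real"
  assumes ge1: "1 \<le> w i" and zero: "w 0 = 1" and submult: "w (i + j) \<le> w i * w j"
begin

lemma nonneg: "0 \<le> w i"
  using ge1[of i] by linarith

text \<open>By submultiplicativity, shifting \<open>b\<close> by \<open>k\<close> increases its norm
  at most by the factor \<open>w k\<close>.\<close>

lemma wl1_conv_weight:
  assumes a: "a \<in> wl1 w" and b: "b \<in> wl1 w"
  shows "conv a b \<in> wl1 w" and "wl1_norm w (conv a b) \<le> wl1_norm w a * wl1_norm w b"
proof -
  have le: "w (j + k) * norm (b j) \<le> w k * (w j * norm (b j))" for j k
    using mult_right_mono[OF submult[of j k], of "norm (b j)"] by (simp add: mult_ac)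
  have sb: "(\<lambda>j. w k * (w j * norm (b j))) summable_on UNIV" for k
    using b by (intro summable_on_cmult_right) (simp add: wl1_def)
  have s: "(\<lambda>j. w (j + k) * norm (b j)) summable_on UNIV" for k
    by (rule summable_on_comparison_test[OF sb[of k]]) (use le nonneg in auto)
  have n: "(\<Sum>\<^sub>\<infinity>j. w (j + k) * norm (b j)) \<le> w k * wl1_norm w b" for k
    using infsum_mono[OF s sb le] by (simp add: wl1_norm_def infsum_cmult_right')
  have "(\<lambda>k. (w k * norm (a k)) * wl1_norm w b) summable_on UNIV"
    using a by (intro summable_on_cmult_left) (simp add: wl1_def)
  hence B: "(\<lambda>k. norm (a k) * (w k * wl1_norm w b)) summable_on UNIV"
    by (simp add: mult_ac)
  have e: "(\<Sum>\<^sub>\<infinity>k. norm (a k) * (w k * wl1_norm w b)) = wl1_norm w a * wl1_norm w b"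
    unfolding wl1_norm_def[of w a] infsum_cmult_left'[symmetric] by (simp add: mult_ac)
  show "conv a b \<in> wl1 w" and "wl1_norm w (conv a b) \<le> wl1_norm w a * wl1_norm w b"
    using wl1_conv[OF nonneg s n B] by (auto simp: e)
qed

lemma wl1_delta0: "delta0 \<in> wl1 w" "wl1_norm w delta0 = 1"
proof -
  show "delta0 \<in> wl1 w"
    by (rule wl1_finite_support, rule finite_subset[of _ "{0}"]) (auto simp: delta0_def)
  have "wl1_norm w delta0 = infsum (\<lambda>i. w i * norm (delta0 i)) {0}"
    unfolding wl1_norm_def by (rule infsum_cong_neutral) (auto simp: delta0_def)
  thus "wl1_norm w delta0 = 1" by (simp add: delta0_def zero)
qed

lemma wl1_conv_power:
  assumes "a \<in> wl1 w"
  shows "conv_power a n \<in> wl1 w" and "wl1_norm w (conv_power a n) \<le> wl1_norm w a ^ n"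
proof -
  have "conv_power a n \<in> wl1 w \<and> wl1_norm w (conv_power a n) \<le> wl1_norm w a ^ n"
  proof (induction n)
    case 0
    then show ?case by (simp add: wl1_delta0)
  next
    case (Suc n)
    have "wl1_norm w (conv a (conv_power a n)) \<le> wl1_norm w a * wl1_norm w (conv_power a n)"
      using Suc assms by (intro wl1_conv_weight) auto
    also have "\<dots> \<le> wl1_norm w a * wl1_norm w a ^ n"
      using Suc by (intro mult_left_mono wl1_norm_nonneg nonneg) auto
    finally show ?case using Suc assms by (auto intro: wl1_conv_weight)
  qed
  thus "conv_power a n \<in> wl1 w" and "wl1_norm w (conv_power a n) \<le> wl1_norm w a ^ n"
    by auto
qed

lemma wl1_subset_wiener:
  assumes "a \<in> wl1 w"
  shows "a \<in> wl1 (\<lambda>_. 1)" and "wl1_norm (\<lambda>_. 1) a \<le> wl1_norm w a"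
  using wl1_mono[OF assms, of "\<lambda>_. 1"] ge1 by auto

end

section \<open>Concrete weights and their truncations\<close>

lemma weight_one: "weight (\<lambda>_. 1)"
  by unfold_locales auto

lemma weight_deriv: "weight (\<lambda>i. 1 + \<bar>of_int i\<bar>)"
  by unfold_locales (auto simp: algebra_simps abs_mult[symmetric] intro: order_trans[OF abs_triangle_ineq])

lemma weight_power:
  assumes "1 \<le> (\<rho>::real)"
  shows "weight (\<lambda>i. \<rho> ^ nat \<bar>i\<bar>)"
proof
  fix i j :: int
  have "\<rho> ^ nat \<bar>i + j\<bar> \<le> \<rho> ^ (nat \<bar>i\<bar> + nat \<bar>j\<bar>)"
    using assms by (intro power_increasing) auto
  thus "\<rho> ^ nat \<bar>i + j\<bar> \<le> \<rho> ^ nat \<bar>i\<bar> * \<rho> ^ nat \<bar>j\<bar>"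
    by (simp add: power_add)
qed (use assms in auto)

text \<open>The weights \<open>min w M\<close> are bounded, so every element of the Wiener class has finite norm for
  them; an estimate uniform in \<open>M\<close> then passes to \<open>w\<close> itself.\<close>

lemma (in weight) weight_min:
  assumes "1 \<le> M"
  shows "weight (\<lambda>i. min (w i) M)"
proof
  fix i j :: int
  show "min (w (i + j)) M \<le> min (w i) M * min (w j) M"
  proof (cases "w i \<le> M \<and> w j \<le> M")
    case True
    then show ?thesis using submult[of i j] by (simp add: min_def)
  next
    case False
    \<comment> \<open>One of the two truncated factors equals \<open>M\<close>, and the other is at
      least 1.\<close>
    have "M \<le> min (w i) M * min (w j) M"
    proof (cases "w i \<le> M")
      case True
      then show ?thesis
        using False assms ge1[of i] mult_right_mono[of 1 "w i" M] by simp
    next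
      case False
      then show ?thesis
        using assms ge1[of j] mult_left_mono[of 1 "min (w j) M" M] by simp
    qed
    then show ?thesis by simp
  qed
qed (use assms ge1 zero in auto)

section \<open>The Wiener algebras\<close>

abbreviation "wone \<equiv> (\<lambda>_. 1 :: real)"
abbreviation "wder \<equiv> (\<lambda>i::int. 1 + \<bar>real_of_int i\<bar>)"

lemma wiener_wl1: "wiener = wl1 wone" "wiener_norm = wl1_norm wone"
  by (auto simp: wiener_def wl1_def wiener_norm_def wl1_norm_def fun_eq_iff)

lemma Fset_wl1: "E \<in> Fset \<longleftrightarrow> case_prod E \<in> wl1 wone" "Fnorm E = wl1_norm wone (case_prod E)"
  by (simp_all add: Fset_def Fnorm_def wl1_def wl1_norm_def case_prod_unfold)

text \<open>Reindexing absorbs the shift by one in the derivative. The weight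
  \<open>\<bar>of_int i\<bar>\<close> vanishes at 0 and so is no instance of \<open>weight\<close>;
  its sum with \<open>wone\<close>, which is \<open>wder\<close>, is one.\<close>

lemma laurent_deriv_wl1:
  shows "laurent_deriv a \<in> wiener \<longleftrightarrow> a \<in> wl1 (\<lambda>i. \<bar>of_int i\<bar>)"
    and "wiener_norm (laurent_deriv a) = wl1_norm (\<lambda>i. \<bar>of_int i\<bar>) a"
proof -
  have eq: "norm (laurent_deriv a i) = \<bar>of_int (i + 1)\<bar> * norm (a (i + 1))" for i
    unfolding laurent_deriv_def norm_mult norm_of_int by (rule refl)
  show "laurent_deriv a \<in> wiener \<longleftrightarrow> a \<in> wl1 (\<lambda>i. \<bar>of_int i\<bar>)"
    unfolding wiener_def wl1_def mem_Collect_eq eq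
    by (rule summable_on_reindex_bij_betw[OF bij_shift(2)])
  show "wiener_norm (laurent_deriv a) = wl1_norm (\<lambda>i. \<bar>of_int i\<bar>) a"
    unfolding wiener_norm_def wl1_norm_def eq
    by (rule infsum_reindex_bij_betw[OF bij_shift(2)])
qed

lemma wiener1_wl1: "wiener1 = wl1 wder"
proof (intro set_eqI iffI)
  fix a assume "a \<in> wiener1"
  hence "(\<lambda>i. norm (a i)) summable_on UNIV" "(\<lambda>i. \<bar>of_int i\<bar> * norm (a i)) summable_on UNIV"
    by (simp_all add: wiener1_def laurent_deriv_wl1(1)) (simp_all add: wiener_def wl1_def)
  from summable_on_add[OF this] show "a \<in> wl1 wder"
    by (simp add: wl1_def algebra_simps)
next
  fix a assume "a \<in> wl1 wder"
  thus "a \<in> wiener1"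
    unfolding wiener1_def mem_Collect_eq laurent_deriv_wl1(1) unfolding wiener_wl1(1)
    by (auto intro!: wl1_mono(1)[of a wder])
qed

lemma wl1_norm_wder:
  assumes "a \<in> wiener1"
  shows "wl1_norm wder a = wiener_norm a + wiener_norm (laurent_deriv a)"
proof -
  have "(\<lambda>i. norm (a i)) summable_on UNIV" "(\<lambda>i. \<bar>of_int i\<bar> * norm (a i)) summable_on UNIV"
    using assms by (simp_all add: wiener1_def laurent_deriv_wl1(1)) (simp_all add: wiener_def wl1_def)
  from infsum_add[OF this] show ?thesis
    unfolding laurent_deriv_wl1(2) by (simp add: wl1_norm_def wiener_norm_def algebra_simps)
qed

lemma cqt_norm_wl1:
  assumes "a \<in> wl1 wder" and "E \<in> Fset"
  shows "cqt_norm (smat_add (toeplitz a) E) = wl1_norm wder a + Fnorm E"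
  using assms unfolding wiener1_wl1[symmetric] by (simp add: cqt_norm_eq wl1_norm_wder)

text \<open>This saves the term \<open>\<parallel>a'\<parallel> \<parallel>b'\<parallel>\<close> over the bound from submultiplicativity of the weight; the
  Hankel product in \<open>T(a) T(b)\<close> uses it up.\<close>

lemma conv_wder:
  assumes a: "a \<in> wiener1" and b: "b \<in> wiener1"
  shows "conv a b \<in> wl1 wder"
    and "wl1_norm wder (conv a b) \<le> wiener_norm a * wiener_norm b
           + wiener_norm (laurent_deriv a) * wiener_norm b + wiener_norm a * wiener_norm (laurent_deriv b)"
proof -
  define q q' where "q = wiener_norm b" and "q' = wiener_norm (laurent_deriv b)"
  have sa: "(\<lambda>i. norm (a i)) summable_on UNIV" "(\<lambda>i. \<bar>of_int i\<bar> * norm (a i)) summable_on UNIV"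
    and sb: "(\<lambda>i. norm (b i)) summable_on UNIV" "(\<lambda>i. \<bar>of_int i\<bar> * norm (b i)) summable_on UNIV"
    using assms by (simp_all add: wiener1_def laurent_deriv_wl1(1)) (simp_all add: wiener_def wl1_def)
  \<comment> \<open>Here \<open>\<bar>j + k\<bar>\<close> is split additively. The bound
    \<open>wder j * wder k\<close> would produce the extra term
    \<open>\<bar>j\<bar> * \<bar>k\<bar>\<close>, that is, the product of the derivative
    norms.\<close>
  have le: "wder (j + k) * norm (b j) \<le> wder k * norm (b j) + \<bar>of_int j\<bar> * norm (b j)" for j k
  proof -
    have "wder (j + k) \<le> wder k + \<bar>of_int j\<bar>" by simp
    from mult_right_mono[OF this, of "norm (b j)"] show ?thesis by (simp add: algebra_simps)
  qed
  have s: "(\<lambda>j. wder k * norm (b j) + \<bar>of_int j\<bar> * norm (b j)) summable_on UNIV" for k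
    by (intro summable_on_add summable_on_cmult_right sb)
  have e: "(\<Sum>\<^sub>\<infinity>j. wder k * norm (b j) + \<bar>of_int j\<bar> * norm (b j)) = wder k * q + q'" for k
    by (subst infsum_add)
       (auto simp: q_def q'_def wiener_norm_def[of b] laurent_deriv_wl1 wl1_norm_def infsum_cmult_right'
          intro!: summable_on_cmult_right sb)
  have s': "(\<lambda>j. wder (j + k) * norm (b j)) summable_on UNIV" for k
    by (rule summable_on_comparison_test[OF s[of k]]) (use le in auto)
  have n: "(\<Sum>\<^sub>\<infinity>j. wder (j + k) * norm (b j)) \<le> wder k * q + q'" for k
    using infsum_mono[OF s' s le] by (simp add: e)
  have eq: "norm (a k) * (wder k * q + q') = norm (a k) * (q + q') + (\<bar>of_int k\<bar> * norm (a k)) * q" for k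
    by (simp add: algebra_simps)
  have B: "(\<lambda>k. norm (a k) * (wder k * q + q')) summable_on UNIV"
    unfolding eq by (intro summable_on_add summable_on_cmult_left sa)
  have "(\<Sum>\<^sub>\<infinity>k. norm (a k) * (wder k * q + q'))
      = wiener_norm a * (q + q') + wiener_norm (laurent_deriv a) * q"
    unfolding eq by (subst infsum_add)
       (auto simp: wiener_norm_def[of a] laurent_deriv_wl1 wl1_norm_def infsum_cmult_left'
          intro!: summable_on_cmult_left sa)
  with wl1_conv[OF _ s' n B]
  show "conv a b \<in> wl1 wder"
    and "wl1_norm wder (conv a b) \<le> wiener_norm a * wiener_norm b
           + wiener_norm (laurent_deriv a) * wiener_norm b + wiener_norm a * wiener_norm (laurent_deriv b)"
    by (auto simp: q_def q'_def algebra_simps)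
qed

section \<open>Products of quasi-Toeplitz matrices\<close>

lemma Fset_rows:
  assumes "E \<in> Fset"
  shows "E i abs_summable_on UNIV" and "(\<lambda>i. \<Sum>\<^sub>\<infinity>j. norm (E i j)) summable_on UNIV"
    and "(\<Sum>\<^sub>\<infinity>i. \<Sum>\<^sub>\<infinity>j. norm (E i j)) = Fnorm E" and "(\<Sum>\<^sub>\<infinity>j. norm (E i j)) \<le> Fnorm E"
proof -
  have s: "case_prod E abs_summable_on (UNIV \<times> UNIV)"
    using assms by (simp add: Fset_def case_prod_unfold)
  show "E i abs_summable_on UNIV" and S: "(\<lambda>i. \<Sum>\<^sub>\<infinity>j. norm (E i j)) summable_on UNIV"
    using s[unfolded Infinite_Sum.abs_summable_on_Sigma_iff] by (auto simp: infsum_nonneg)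
  show e: "(\<Sum>\<^sub>\<infinity>i. \<Sum>\<^sub>\<infinity>j. norm (E i j)) = Fnorm E"
    using infsum_Sigma_banach[OF s] by (simp add: Fnorm_def case_prod_unfold)
  show "(\<Sum>\<^sub>\<infinity>j. norm (E i j)) \<le> Fnorm E"
    using finite_sum_le_infsum[OF S, of "{i}"] by (simp add: e infsum_nonneg)
qed

lemma Fset_transpose:
  assumes "E \<in> Fset"
  shows "(\<lambda>i j. E j i) \<in> Fset" and "Fnorm (\<lambda>i j. E j i) = Fnorm E"
proof -
  have b: "bij (prod.swap :: nat \<times> nat \<Rightarrow> _)" by simp
  show "(\<lambda>i j. E j i) \<in> Fset"
    using assms summable_on_reindex_bij_betw[OF b, of "\<lambda>(i, j). norm (E i j)"]
    by (simp add: Fset_def case_prod_unfold)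
  show "Fnorm (\<lambda>i j. E j i) = Fnorm E"
    using infsum_reindex_bij_betw[OF b, of "\<lambda>(i, j). norm (E i j)"]
    by (simp add: Fnorm_def case_prod_unfold)
qed

lemmas Fset_cols = Fset_rows[OF Fset_transpose(1), unfolded Fset_transpose(2)]

text \<open>The product is a sum over \<open>k\<close> of rank-one matrices, column \<open>k\<close>
  of \<open>P\<close> times row \<open>k\<close> of \<open>Q\<close>. The entrywise norm of each is
  the product of a column sum and a row sum.\<close>

lemma Fset_mult:
  assumes P: "\<And>k. (\<lambda>i. P i k) abs_summable_on UNIV" and Q: "\<And>k. Q k abs_summable_on UNIV"
    and le: "\<And>k. (\<Sum>\<^sub>\<infinity>i. norm (P i k)) * (\<Sum>\<^sub>\<infinity>j. norm (Q k j)) \<le> B k"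
    and B: "B summable_on UNIV"
  shows "smat_mult P Q \<in> Fset" and "Fnorm (smat_mult P Q) \<le> infsum B UNIV"
    and "(\<lambda>k. P i k * Q k j) summable_on UNIV"
proof -
  define u where "u = (\<lambda>k (i, j). P i k * Q k j)"
  have 1: "(\<lambda>(i, j). norm (P i k) * norm (Q k j)) abs_summable_on UNIV \<times> UNIV" for k
    using P[of k] Q[of k]
    by (subst Infinite_Sum.abs_summable_on_Sigma_iff)
       (auto simp: infsum_nonneg infsum_cmult_right' intro!: summable_on_cmult_right summable_on_cmult_left)
  have "norm (u k x) = (case x of (i, j) \<Rightarrow> norm (P i k) * norm (Q k j))" for k x
    by (simp add: u_def case_prod_unfold norm_mult)
  hence eq: "(\<lambda>x. norm (u k x)) = (\<lambda>(i, j). norm (P i k) * norm (Q k j))" for k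
    by blast
  have 2: "u k abs_summable_on UNIV" for k
    unfolding eq using abs_summable_summable[OF 1[of k]] by simp
  have 3: "(\<Sum>\<^sub>\<infinity>x. norm (u k x)) \<le> B k" for k
    unfolding eq using infsum_Sigma_banach[OF abs_summable_summable[OF 1[of k]]] le[of k]
    by (simp add: infsum_cmult_right' infsum_cmult_left')
  have e: "(\<Sum>\<^sub>\<infinity>k. u k x) = (case x of (i, j) \<Rightarrow> smat_mult P Q i j)" for x
    by (simp add: u_def smat_mult_def case_prod_unfold)
  note fam = abs_summable_family[OF 2 3 B]
  show "smat_mult P Q \<in> Fset" using fam(3) by (simp add: Fset_def e case_prod_unfold)
  show "Fnorm (smat_mult P Q) \<le> infsum B UNIV"
    using fam(4) by (simp add: Fnorm_def e case_prod_unfold)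
  show "(\<lambda>k. P i k * Q k j) summable_on UNIV"
    using abs_summable_summable[OF fam(2)[of "(i, j)"]] by (simp add: u_def)
qed

text \<open>One half of the ideal property: uniformly bounded column sums of the left factor
  suffice. This covers a Toeplitz factor, with \<open>C\<close> its Wiener norm, as well as a
  summable one.\<close>

lemma Fset_mult_left:
  assumes P: "\<And>k. (\<lambda>i. P i k) abs_summable_on UNIV" and "\<And>k. (\<Sum>\<^sub>\<infinity>i. norm (P i k)) \<le> C"
    and Q: "Q \<in> Fset"
  shows "smat_mult P Q \<in> Fset" and "Fnorm (smat_mult P Q) \<le> C * Fnorm Q"
    and "(\<lambda>k. P i k * Q k j) summable_on UNIV"
proof -
  have le: "(\<Sum>\<^sub>\<infinity>i. norm (P i k)) * (\<Sum>\<^sub>\<infinity>j. norm (Q k j)) \<le> C * (\<Sum>\<^sub>\<infinity>j. norm (Q k j))" for k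
    using assms(2) by (rule mult_right_mono) (simp add: infsum_nonneg)
  note r = Fset_mult[OF P Fset_rows(1)[OF Q] le summable_on_cmult_right[OF Fset_rows(2)[OF Q]]]
  show "smat_mult P Q \<in> Fset" and "Fnorm (smat_mult P Q) \<le> C * Fnorm Q"
    and "(\<lambda>k. P i k * Q k j) summable_on UNIV"
    using r by (simp_all add: infsum_cmult_right' Fset_rows(3)[OF Q])
qed

lemma Fset_mult_right:
  assumes Q: "\<And>k. Q k abs_summable_on UNIV" and "\<And>k. (\<Sum>\<^sub>\<infinity>j. norm (Q k j)) \<le> C"
    and P: "P \<in> Fset"
  shows "smat_mult P Q \<in> Fset" and "Fnorm (smat_mult P Q) \<le> Fnorm P * C"
    and "(\<lambda>k. P i k * Q k j) summable_on UNIV"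
proof -
  have le: "(\<Sum>\<^sub>\<infinity>i. norm (P i k)) * (\<Sum>\<^sub>\<infinity>j. norm (Q k j)) \<le> (\<Sum>\<^sub>\<infinity>i. norm (P i k)) * C" for k
    using assms(2) by (rule mult_left_mono) (simp add: infsum_nonneg)
  note r = Fset_mult[OF Fset_cols(1)[OF P] Q le summable_on_cmult_left[OF Fset_cols(2)[OF P]]]
  show "smat_mult P Q \<in> Fset" and "Fnorm (smat_mult P Q) \<le> Fnorm P * C"
    and "(\<lambda>k. P i k * Q k j) summable_on UNIV"
    using r by (simp_all add: infsum_cmult_left' Fset_cols(3)[OF P] Fset_transpose(2)[OF P])
qed

text \<open>With indices starting at 0, the value \<open>h m\<close> for \<open>m > 0\<close> fills
  the \<open>m\<close> entries with \<open>i + k + 1 = m\<close>, so the entrywise norm counts it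
  \<open>m\<close> times. This is where the derivative norm enters.\<close>

lemma Fset_hankel:
  assumes h: "h \<in> wl1 (\<lambda>i. \<bar>of_int i\<bar>)"
  shows "(\<lambda>i k. h (int i + int k + 1)) \<in> Fset"
    and "Fnorm (\<lambda>i k. h (int i + int k + 1)) \<le> wl1_norm (\<lambda>i. \<bar>of_int i\<bar>) h"
proof -
  define g where "g = (\<lambda>m::nat. norm (h (int m)))"
  have hs: "(\<lambda>i. \<bar>of_int i\<bar> * norm (h i)) summable_on UNIV" using h by (simp add: wl1_def)
  have hs': "(\<lambda>i. \<bar>of_int i\<bar> * norm (h i)) summable_on range int"
    by (rule summable_on_subset_banach[OF hs]) simp
  have s: "(\<lambda>m. real m * g m) summable_on UNIV"
    using iffD1[OF summable_on_reindex[OF inj_of_nat] hs'] by (simp add: o_def g_def)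
  have n: "(\<Sum>\<^sub>\<infinity>m. real m * g m) \<le> wl1_norm (\<lambda>i. \<bar>of_int i\<bar>) h"
  proof -
    have "(\<Sum>\<^sub>\<infinity>m. real m * g m) = (\<Sum>\<^sub>\<infinity>i\<in>range int. \<bar>of_int i\<bar> * norm (h i))"
      by (subst infsum_reindex) (simp_all add: o_def g_def)
    also have "\<dots> \<le> (\<Sum>\<^sub>\<infinity>i. \<bar>of_int i\<bar> * norm (h i))"
      by (rule infsum_mono2[OF hs' hs]) auto
    finally show ?thesis by (simp add: wl1_norm_def)
  qed
  have S: "(\<lambda>(m, k). g m) summable_on (SIGMA m:UNIV. {..<m})"
  proof (rule summable_on_SigmaI)
    show "((\<lambda>k. case (m, k) of (m, k) \<Rightarrow> g m) has_sum real m * g m) {..<m}" for m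
      by (rule has_sum_finiteI) simp_all
  qed (use s in \<open>simp_all add: g_def\<close>)
  have N: "(\<Sum>\<^sub>\<infinity>(m, k)\<in>(SIGMA m:UNIV. {..<m}). g m) = (\<Sum>\<^sub>\<infinity>m. real m * g m)"
    using infsum_Sigma_banach[OF S] by (simp add: case_prod_unfold)
  \<comment> \<open>A matrix entry is located by its antidiagonal \<open>m = i + k + 1\<close> and
    its column \<open>k < m\<close>.\<close>
  have bij: "bij_betw (\<lambda>(i, k). (i + k + 1, k)) UNIV (SIGMA m:UNIV. {..<m::nat})"
    unfolding bij_betw_def inj_on_def image_def
  proof (intro conjI set_eqI iffI)
    fix x assume "x \<in> (SIGMA m:UNIV. {..<m::nat})"
    then obtain m k where "x = (m, k)" "k < m" by blast
    then have "x = (case (m - k - 1, k) of (i, k) \<Rightarrow> (i + k + 1, k))" by simp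
    then show "x \<in> {y. \<exists>x\<in>UNIV. y = (case x of (i, k) \<Rightarrow> (i + k + 1, k))}" by blast
  qed auto
  have e: "(case (case x of (i, k) \<Rightarrow> (i + k + 1, k)) of (m, k) \<Rightarrow> g m)
      = (case x of (i, k) \<Rightarrow> norm (h (int i + int k + 1)))" for x
    by (simp add: g_def case_prod_unfold algebra_simps)
  show "(\<lambda>i k. h (int i + int k + 1)) \<in> Fset"
    using summable_on_reindex_bij_betw[OF bij, of "\<lambda>(m, k). g m", unfolded e] S by (simp add: Fset_def)
  show "Fnorm (\<lambda>i k. h (int i + int k + 1)) \<le> wl1_norm (\<lambda>i. \<bar>of_int i\<bar>) h"
    using infsum_reindex_bij_betw[OF bij, of "\<lambda>(m, k). g m", unfolded e] N n by (simp add: Fnorm_def)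
qed

lemma abs_summable_inj:
  fixes h :: "'b \<Rightarrow> complex"
  assumes "h abs_summable_on UNIV" and "inj f"
  shows "(\<lambda>i. h (f i)) abs_summable_on UNIV" and "(\<Sum>\<^sub>\<infinity>i. norm (h (f i))) \<le> (\<Sum>\<^sub>\<infinity>i. norm (h i))"
proof -
  have s: "(\<lambda>i. norm (h i)) summable_on range f"
    by (rule summable_on_subset_banach[OF assms(1)]) simp
  show "(\<lambda>i. h (f i)) abs_summable_on UNIV"
    using s summable_on_reindex[OF assms(2), of "\<lambda>i. norm (h i)"] by (simp add: o_def)
  have "(\<Sum>\<^sub>\<infinity>i. norm (h (f i))) = (\<Sum>\<^sub>\<infinity>i\<in>range f. norm (h i))"
    using infsum_reindex[OF assms(2), of "\<lambda>i. norm (h i)"] by (simp add: o_def)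
  also have "\<dots> \<le> (\<Sum>\<^sub>\<infinity>i. norm (h i))"
    by (rule infsum_mono2[OF s assms(1)]) auto
  finally show "(\<Sum>\<^sub>\<infinity>i. norm (h (f i))) \<le> (\<Sum>\<^sub>\<infinity>i. norm (h i))" .
qed

lemma wiener_bound:
  assumes "b \<in> wiener"
  shows "norm (b i) \<le> wiener_norm b"
  using finite_sum_le_infsum[of "\<lambda>i. norm (b i)" UNIV "{i}"] assms
  by (simp add: wiener_def wiener_norm_def)

lemma conv_abs_summable:
  assumes "a \<in> wiener" and "b \<in> wiener"
  shows "(\<lambda>k. a k * b (i - k)) abs_summable_on UNIV"
proof (rule summable_on_comparison_test)
  show "(\<lambda>k. norm (a k) * wiener_norm b) summable_on UNIV"
    using assms by (intro summable_on_cmult_left) (simp add: wiener_def)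
  show "norm (a k * b (i - k)) \<le> norm (a k) * wiener_norm b" for k
    using wiener_bound[OF assms(2)] by (simp add: norm_mult mult_left_mono)
qed simp

text \<open>The correction to \<open>T(a) T(b) = T(ab)\<close> is the product of two Hankel matrices, which come from
  the negative indices missing in the summation.\<close>

lemma toeplitz_mult_toeplitz:
  assumes a: "a \<in> wiener" and b: "b \<in> wiener"
  shows "(\<lambda>k. toeplitz a i k * toeplitz b k j) summable_on UNIV"
    and "(\<Sum>\<^sub>\<infinity>k. toeplitz a i k * toeplitz b k j) = conv a b (int j - int i)
      - smat_mult (\<lambda>i k. a (- (int i + int k + 1))) (\<lambda>k j. b (int k + int j + 1)) i j"
proof -
  \<comment> \<open>The summand of the full convolution, shifted so that \<open>m\<close> is the
    inner matrix index. Its part over \<open>m \<ge> 0\<close> is the matrix product; its part over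
    \<open>m = - k - 1\<close> is the Hankel product.\<close>
  define t where "t = (\<lambda>m. a (m - int i) * b (int j - m))"
  have ts: "t summable_on UNIV" and te: "infsum t UNIV = conv a b (int j - int i)"
    using abs_summable_summable[OF conv_abs_summable[OF a b, of "int j - int i"]]
      summable_on_reindex_bij_betw[OF bij_shift(1), of "\<lambda>k. a k * b (int j - int i - k)" "int i"]
      infsum_reindex_bij_betw[OF bij_shift(1), of "\<lambda>k. a k * b (int j - int i - k)" "int i"]
    by (simp_all add: t_def conv_def)
  define n where "n = (\<lambda>k. - int k - 1)"
  have inj: "inj n" by (auto simp: n_def inj_on_def)
  have un: "UNIV = range int \<union> range n"
  proof (intro set_eqI iffI)
    fix x :: int
    show "x \<in> range int \<union> range n"
    proof (cases "0 \<le> x")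
      case True
      then have "x = int (nat x)" by simp
      then show ?thesis by blast
    next
      case False
      then have "x = n (nat (- x - 1))" by (simp add: n_def)
      then show ?thesis by blast
    qed
  qed auto
  have disj: "range int \<inter> range n = {}" by (auto simp: n_def)
  have s1: "t summable_on range int" and s2: "t summable_on range n"
    by (rule summable_on_subset_banach[OF ts], simp)+
  show "(\<lambda>k. toeplitz a i k * toeplitz b k j) summable_on UNIV"
    using s1 summable_on_reindex[OF inj_of_nat, of t] by (simp add: o_def t_def toeplitz_def)
  have "infsum t UNIV = infsum t (range int) + infsum t (range n)"
    unfolding un by (rule infsum_Un_disjoint[OF s1 s2 disj])
  also have "infsum t (range int) = (\<Sum>\<^sub>\<infinity>k. toeplitz a i k * toeplitz b k j)"
    using infsum_reindex[OF inj_of_nat, of t] by (simp add: o_def t_def toeplitz_def)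
  also have "infsum t (range n)
      = smat_mult (\<lambda>i k. a (- (int i + int k + 1))) (\<lambda>k j. b (int k + int j + 1)) i j"
  proof -
    have "t (n k) = a (- (int i + int k + 1)) * b (int k + int j + 1)" for k
      unfolding t_def n_def by (intro arg_cong2[where f = "(*)"] arg_cong[where f = a] arg_cong[where f = b]) auto
    then show ?thesis
      using infsum_reindex[OF inj, of t] by (simp add: o_def smat_mult_def)
  qed
  finally show "(\<Sum>\<^sub>\<infinity>k. toeplitz a i k * toeplitz b k j) = conv a b (int j - int i)
      - smat_mult (\<lambda>i k. a (- (int i + int k + 1))) (\<lambda>k j. b (int k + int j + 1)) i j"
    by (simp add: te)
qed

lemma Fset_add:
  assumes "E \<in> Fset" and "F \<in> Fset"
  shows "smat_add E F \<in> Fset" and "Fnorm (smat_add E F) \<le> Fnorm E + Fnorm F"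
  using wl1_add[of wone "case_prod E" "case_prod F"] assms
  by (simp_all add: Fset_wl1 smat_add_def case_prod_unfold)

lemma Fset_minus:
  assumes "E \<in> Fset"
  shows "(\<lambda>i j. - E i j) \<in> Fset" and "Fnorm (\<lambda>i j. - E i j) = Fnorm E"
  using wl1_minus[where a = "case_prod E" and w = wone] assms
  by (simp_all add: Fset_wl1 case_prod_unfold)

lemma Fset_zero: "(\<lambda>i j. 0) \<in> Fset" "Fnorm (\<lambda>i j. 0) = 0"
  by (simp_all add: Fset_def Fnorm_def case_prod_unfold)

lemma Fnorm_nonneg: "0 \<le> Fnorm E"
  unfolding Fset_wl1 by (rule wl1_norm_nonneg) simp

lemma wiener_norm_nonneg: "0 \<le> wiener_norm a"
  unfolding wiener_wl1 by (rule wl1_norm_nonneg) simp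

text \<open>Multiplying out leaves the convolution of the symbols, three products with a summable
  factor, and the Hankel product. The last costs the product of the derivative norms, just the term
  that \<open>conv_wder\<close> saves, so the norm stays submultiplicative.\<close>

lemma cqt_mult:
  assumes a: "a \<in> wiener1" and b: "b \<in> wiener1" and E: "E \<in> Fset" and F: "F \<in> Fset"
  obtains G where "G \<in> Fset"
    and "smat_mult (smat_add (toeplitz a) E) (smat_add (toeplitz b) F) = smat_add (toeplitz (conv a b)) G"
    and "wl1_norm wder (conv a b) + Fnorm G \<le> (wl1_norm wder a + Fnorm E) * (wl1_norm wder b + Fnorm F)"
proof -
  have aw: "a \<in> wiener" and bw: "b \<in> wiener" using a b by (auto simp: wiener1_def)
  define H K where "H = (\<lambda>i k. a (- (int i + int k + 1)))" and "K = (\<lambda>k j. b (int k + int j + 1))"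
  have inj: "inj (\<lambda>i. int k - int i)" "inj (\<lambda>j. int j - int k)" for k
    by (auto simp: inj_on_def)
  have Ta: "(\<lambda>i. toeplitz a i k) abs_summable_on UNIV" "(\<Sum>\<^sub>\<infinity>i. norm (toeplitz a i k)) \<le> wiener_norm a" for k
    using abs_summable_inj[OF _ inj(1)[of k], of a] aw
    by (simp_all add: toeplitz_def wiener_def wiener_norm_def)
  have Tb: "toeplitz b k abs_summable_on UNIV" "(\<Sum>\<^sub>\<infinity>j. norm (toeplitz b k j)) \<le> wiener_norm b" for k
    using abs_summable_inj[OF _ inj(2)[of k], of b] bw
    by (simp_all add: toeplitz_def wiener_def wiener_norm_def)
  \<comment> \<open>The left Hankel factor holds the negative coefficients of \<open>a\<close>;
    reflection brings it to the form of \<open>Fset_hankel\<close> and preserves the weight.\<close>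
  have am: "(\<lambda>i. a (- i)) \<in> wl1 (\<lambda>i. \<bar>of_int i\<bar>)"
    and an: "wl1_norm (\<lambda>i. \<bar>of_int i\<bar>) (\<lambda>i. a (- i)) = wiener_norm (laurent_deriv a)"
  proof -
    have bij: "bij (uminus :: int \<Rightarrow> int)" by (rule bij_uminus)
    have "a \<in> wl1 (\<lambda>i. \<bar>of_int i\<bar>)" using a by (simp add: wiener1_def laurent_deriv_wl1(1))
    thus "(\<lambda>i. a (- i)) \<in> wl1 (\<lambda>i. \<bar>of_int i\<bar>)"
      using summable_on_reindex_bij_betw[OF bij, of "\<lambda>i. \<bar>of_int i\<bar> * norm (a i)"]
      by (simp add: wl1_def)
    show "wl1_norm (\<lambda>i. \<bar>of_int i\<bar>) (\<lambda>i. a (- i)) = wiener_norm (laurent_deriv a)"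
      unfolding laurent_deriv_wl1(2)
      using infsum_reindex_bij_betw[OF bij, of "\<lambda>i. \<bar>of_int i\<bar> * norm (a i)"]
      by (simp add: wl1_norm_def)
  qed
  have bm: "b \<in> wl1 (\<lambda>i. \<bar>of_int i\<bar>)"
    and bn: "wl1_norm (\<lambda>i. \<bar>of_int i\<bar>) b = wiener_norm (laurent_deriv b)"
    using b by (simp_all add: wiener1_def laurent_deriv_wl1)
  have HF: "H \<in> Fset" "Fnorm H \<le> wiener_norm (laurent_deriv a)"
    using Fset_hankel[OF am] an by (simp_all add: H_def)
  have KF: "K \<in> Fset" "Fnorm K \<le> wiener_norm (laurent_deriv b)"
    using Fset_hankel[OF bm] bn by (simp_all add: K_def)
  have "(\<Sum>\<^sub>\<infinity>i. norm (H i k)) \<le> wiener_norm (laurent_deriv a)" for k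
    using Fset_cols(4)[OF HF(1), of k] HF(2) unfolding Fset_transpose(2)[OF HF(1)] by linarith
  note HK = Fset_mult_left[where P = H, OF Fset_cols(1)[OF HF(1)] this KF(1)]
  note TF = Fset_mult_left[where P = "toeplitz a", OF Ta F]
  note ET = Fset_mult_right[where Q = "toeplitz b", OF Tb E]
  note EF = Fset_mult_left[where P = E, OF Fset_cols(1)[OF E] Fset_cols(4)[OF E] F, unfolded Fset_transpose(2)[OF E]]
  define G where "G = smat_add (smat_add (smat_mult (toeplitz a) F) (smat_mult E (toeplitz b)))
      (smat_add (smat_mult E F) (\<lambda>i j. - smat_mult H K i j))"
  define p p' q q' where "p = wiener_norm a" and "p' = wiener_norm (laurent_deriv a)"
    and "q = wiener_norm b" and "q' = wiener_norm (laurent_deriv b)"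
  note nn = wiener_norm_nonneg[of a, folded p_def] wiener_norm_nonneg[of b, folded q_def]
    wiener_norm_nonneg[of "laurent_deriv a", folded p'_def] wiener_norm_nonneg[of "laurent_deriv b", folded q'_def]
  have "p' * Fnorm K \<le> p' * q'"
    using KF(2) nn unfolding q'_def by (intro mult_left_mono) auto
  hence HKn: "Fnorm (smat_mult H K) \<le> p' * q'"
    using HK(2) by (simp add: p'_def)
  note mem = TF(1) ET(1) EF(1) HK(1)
  have GF: "G \<in> Fset"
    unfolding G_def by (intro Fset_add Fset_minus mem)
  have "Fnorm G \<le> Fnorm (smat_add (smat_mult (toeplitz a) F) (smat_mult E (toeplitz b)))
      + Fnorm (smat_add (smat_mult E F) (\<lambda>i j. - smat_mult H K i j))"
    unfolding G_def by (intro Fset_add Fset_minus mem)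
  also have "\<dots> \<le> (Fnorm (smat_mult (toeplitz a) F) + Fnorm (smat_mult E (toeplitz b)))
      + (Fnorm (smat_mult E F) + Fnorm (\<lambda>i j. - smat_mult H K i j))"
    by (intro add_mono Fset_add Fset_minus mem)
  also have "\<dots> \<le> (p * Fnorm F + Fnorm E * q) + (Fnorm E * Fnorm F + p' * q')"
    unfolding Fset_minus(2)[OF HK(1)]
    using TF(2) ET(2) EF(2) HKn unfolding p_def q_def by (intro add_mono) auto
  finally have Gn: "Fnorm G \<le> (p * Fnorm F + Fnorm E * q) + (Fnorm E * Fnorm F + p' * q')" .
  have "smat_mult (smat_add (toeplitz a) E) (smat_add (toeplitz b) F) i j
      = smat_add (toeplitz (conv a b)) G i j" for i j
  proof -
    note s1 = toeplitz_mult_toeplitz(1)[OF aw bw, of i j]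
    note s2 = TF(3)[of i j] and s3 = ET(3)[of i j] and s4 = EF(3)[of i j]
    have "smat_mult (smat_add (toeplitz a) E) (smat_add (toeplitz b) F) i j
      = (\<Sum>\<^sub>\<infinity>k. (toeplitz a i k * toeplitz b k j + toeplitz a i k * F k j)
            + (E i k * toeplitz b k j + E i k * F k j))"
      unfolding smat_mult_def smat_add_def by (simp add: algebra_simps)
    also have "\<dots> = ((\<Sum>\<^sub>\<infinity>k. toeplitz a i k * toeplitz b k j) + (\<Sum>\<^sub>\<infinity>k. toeplitz a i k * F k j))
            + ((\<Sum>\<^sub>\<infinity>k. E i k * toeplitz b k j) + (\<Sum>\<^sub>\<infinity>k. E i k * F k j))"
      by (simp add: infsum_add summable_on_add s1 s2 s3 s4)
    also have "\<dots> = smat_add (toeplitz (conv a b)) G i j"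
      unfolding toeplitz_mult_toeplitz(2)[OF aw bw] H_def[symmetric] K_def[symmetric]
      by (simp add: G_def smat_add_def smat_mult_def toeplitz_def)
    finally show ?thesis .
  qed
  hence eq: "smat_mult (smat_add (toeplitz a) E) (smat_add (toeplitz b) F) = smat_add (toeplitz (conv a b)) G"
    by blast
  have "wl1_norm wder (conv a b) \<le> p * q + p' * q + p * q'"
    using conv_wder(2)[OF a b] by (simp add: p_def q_def p'_def q'_def)
  with Gn have "wl1_norm wder (conv a b) + Fnorm G \<le> (p * q + p' * q + p * q')
     + ((p * Fnorm F + Fnorm E * q) + (Fnorm E * Fnorm F + p' * q'))"
    by linarith
  \<comment> \<open>The right side exceeds the left by
    \<open>p' * Fnorm F + Fnorm E * q'\<close>.\<close>
  also have "\<dots> \<le> (p + p' + Fnorm E) * (q + q' + Fnorm F)"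
    using nn mult_nonneg_nonneg[OF nn(3) Fnorm_nonneg[of F]] mult_nonneg_nonneg[OF Fnorm_nonneg[of E] nn(4)]
    by (simp add: algebra_simps)
  finally have "wl1_norm wder (conv a b) + Fnorm G \<le> (wl1_norm wder a + Fnorm E) * (wl1_norm wder b + Fnorm F)"
    by (simp add: wl1_norm_wder[OF a] wl1_norm_wder[OF b] p_def p'_def q_def q'_def)
  from that[OF GF eq this] show ?thesis .
qed

interpretation wder: weight wder by (rule weight_deriv)

lemma smat_one_toeplitz: "smat_one = smat_add (toeplitz delta0) (\<lambda>i j. 0)"
  by (auto simp: smat_one_def smat_add_def toeplitz_def delta0_def fun_eq_iff)

text \<open>Symbol and correction are bounded jointly, because the correction of a product also
  depends on the symbols of its factors; the joint bound is what the induction preserves.\<close>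

lemma cqt_power:
  assumes a: "a \<in> wiener1" and E: "E \<in> Fset"
  shows "\<exists>G\<in>Fset. smat_power (smat_add (toeplitz a) E) n = smat_add (toeplitz (conv_power a n)) G
    \<and> wl1_norm wder (conv_power a n) + Fnorm G \<le> (wl1_norm wder a + Fnorm E) ^ n"
proof (induction n)
  case 0
  show ?case
    by (rule bexI[OF _ Fset_zero(1)]) (simp add: smat_one_toeplitz wder.wl1_delta0 Fset_zero)
next
  case (Suc n)
  then obtain F where F: "F \<in> Fset"
    "smat_power (smat_add (toeplitz a) E) n = smat_add (toeplitz (conv_power a n)) F"
    "wl1_norm wder (conv_power a n) + Fnorm F \<le> (wl1_norm wder a + Fnorm E) ^ n"
    by blast
  have "conv_power a n \<in> wiener1"
    using a unfolding wiener1_wl1 by (rule wder.wl1_conv_power)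
  from cqt_mult[OF a this E F(1)] obtain G where G: "G \<in> Fset"
    "smat_mult (smat_add (toeplitz a) E) (smat_add (toeplitz (conv_power a n)) F)
      = smat_add (toeplitz (conv a (conv_power a n))) G"
    "wl1_norm wder (conv a (conv_power a n)) + Fnorm G
      \<le> (wl1_norm wder a + Fnorm E) * (wl1_norm wder (conv_power a n) + Fnorm F)"
    by blast
  note G(3)
  also have "(wl1_norm wder a + Fnorm E) * (wl1_norm wder (conv_power a n) + Fnorm F)
      \<le> (wl1_norm wder a + Fnorm E) * (wl1_norm wder a + Fnorm E) ^ n"
    by (intro mult_left_mono F add_nonneg_nonneg Fnorm_nonneg wl1_norm_nonneg) simp_all
  finally show ?case using G F by auto
qed

text \<open>The product has symbol \<open>conv a b\<close> and the identity has symbol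
  \<open>delta0\<close>; the decomposition is unique.\<close>

lemma cqt_inverse_conv:
  assumes a: "a \<in> wiener1" and b: "b \<in> wiener1" and E: "E \<in> Fset" and F: "F \<in> Fset"
    and "smat_mult (smat_add (toeplitz a) E) (smat_add (toeplitz b) F) = smat_one"
  shows "conv a b = delta0"
  using cqt_mult[OF a b E F] assms(5) toeplitz_add_unique(1)[OF _ _ Fset_zero(1)] smat_one_toeplitz
  by metis

section \<open>Laurent series in a matrix\<close>

text \<open>Up to sign, the error of a symmetric partial sum is the series over the complementary
  indices, whose norm is at most the corresponding tail of \<open>B\<close>.\<close>

lemma wl1_series_tendsto:
  fixes u :: "int \<Rightarrow> 'x \<Rightarrow> complex"
  assumes w: "\<And>i. 1 \<le> w i" and u: "\<And>n. u n \<in> wl1 w"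
    and le: "\<And>n. wl1_norm w (u n) \<le> B n" and B: "B summable_on UNIV"
  shows "(\<lambda>j. \<Sum>\<^sub>\<infinity>n. u n j) \<in> wl1 w"
    and "(\<lambda>j. (\<Sum>n=-int k..int k. u n j) - (\<Sum>\<^sub>\<infinity>n. u n j)) \<in> wl1 w"
    and "(\<lambda>k. wl1_norm w (\<lambda>j. (\<Sum>n=-int k..int k. u n j) - (\<Sum>\<^sub>\<infinity>n. u n j))) \<longlonglongrightarrow> 0"
proof -
  have w0: "0 \<le> w i" for i using w[of i] by linarith
  define S where "S = (\<lambda>k. {-int k..int k})"
  have S: "{-int k..int k} = S k" for k by (simp add: S_def)
  have Bt: "B summable_on (- S k)" for k
    by (rule summable_on_subset_banach[OF B]) simp
  show "(\<lambda>j. \<Sum>\<^sub>\<infinity>n. u n j) \<in> wl1 w"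
    by (rule wl1_family[OF w0 u le B])
  note tail = wl1_family[where N = "- S k" for k, OF w0 u le Bt]
  \<comment> \<open>Since weights are at least 1, every single coefficient is bounded by the norm,
    hence by \<open>B n\<close>.\<close>
  have pt: "(\<lambda>n. u n j) summable_on UNIV" for j
  proof (rule abs_summable_summable, rule summable_on_comparison_test[OF B])
    fix n
    have "w j * norm (u n j) \<le> wl1_norm w (u n)"
      using finite_sum_le_infsum[of "\<lambda>j. w j * norm (u n j)" UNIV "{j}"] u[of n] w0
      by (simp add: wl1_def wl1_norm_def)
    moreover have "norm (u n j) \<le> w j * norm (u n j)"
      using mult_right_mono[OF w[of j], of "norm (u n j)"] by simp
    ultimately show "norm (u n j) \<le> B n" using le[of n] by linarith
  qed simp
  have eq: "(\<Sum>n\<in>S k. u n j) - (\<Sum>\<^sub>\<infinity>n. u n j) = - (\<Sum>\<^sub>\<infinity>n\<in>- S k. u n j)" for k j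
  proof -
    have "(\<Sum>\<^sub>\<infinity>n\<in>S k \<union> - S k. u n j) = (\<Sum>\<^sub>\<infinity>n\<in>S k. u n j) + (\<Sum>\<^sub>\<infinity>n\<in>- S k. u n j)"
      by (rule infsum_Un_disjoint) (auto intro: summable_on_subset_banach[OF pt])
    then show ?thesis by (simp add: S_def)
  qed
  show "(\<lambda>j. (\<Sum>n=-int k..int k. u n j) - (\<Sum>\<^sub>\<infinity>n. u n j)) \<in> wl1 w"
    unfolding S eq by (intro wl1_minus tail)
  \<comment> \<open>The symmetric intervals eventually contain every finite set, so convergence
    along finite subsets yields convergence along this sequence.\<close>
  have "filterlim S (finite_subsets_at_top UNIV) sequentially"
    unfolding filterlim_finite_subsets_at_top
  proof (intro allI impI)
    fix X :: "int set" assume "finite X \<and> X \<subseteq> UNIV"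
    then have fin: "finite (insert 0 (nat ` abs ` X))" by simp
    define K where "K = Max (insert 0 (nat ` abs ` X))"
    have "nat \<bar>x\<bar> \<le> K" if "x \<in> X" for x
      unfolding K_def by (rule Max_ge[OF fin]) (use that in auto)
    then have "X \<subseteq> S k" if "K \<le> k" for k
      using that unfolding S_def by force
    then show "\<forall>\<^sub>F y in sequentially. finite (S y) \<and> X \<subseteq> S y \<and> S y \<subseteq> UNIV"
      unfolding eventually_sequentially by (intro exI[of _ K]) (auto simp: S_def)
  qed
  from filterlim_compose[OF infsum_tendsto[OF B] this]
  have "(\<lambda>k. infsum B UNIV - sum B (S k)) \<longlonglongrightarrow> infsum B UNIV - infsum B UNIV"
    by (intro tendsto_diff tendsto_const)
  moreover have "infsum B UNIV - sum B (S k) = infsum B (- S k)" for k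
  proof -
    have "infsum B (S k \<union> - S k) = infsum B (S k) + infsum B (- S k)"
      by (rule infsum_Un_disjoint[OF summable_on_subset_banach[OF B] Bt]) auto
    then show ?thesis by (simp add: S_def)
  qed
  ultimately have lim: "(\<lambda>k. infsum B (- S k)) \<longlonglongrightarrow> 0" by simp
  show "(\<lambda>k. wl1_norm w (\<lambda>j. (\<Sum>n=-int k..int k. u n j) - (\<Sum>\<^sub>\<infinity>n. u n j))) \<longlonglongrightarrow> 0"
    unfolding S eq wl1_minus(2)
    by (rule tendsto_sandwich[OF _ _ tendsto_const lim])
       (auto intro!: always_eventually tail(2) wl1_norm_nonneg w0)
qed

text \<open>Symbols and corrections are summed separately, with weights \<open>wder\<close> and
  \<open>wone\<close>. The error splits in the same way, so its \<open>CQT\<close> norm is the sum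
  of two null sequences.\<close>

lemma cqt_series:
  assumes d: "\<And>i. d i \<in> wiener1" and D: "\<And>i. D i \<in> Fset"
    and le: "\<And>i. wl1_norm wder (d i) + Fnorm (D i) \<le> B i"
    and B: "(\<lambda>i. norm (c i) * B i) summable_on UNIV"
  defines "g \<equiv> (\<lambda>j. \<Sum>\<^sub>\<infinity>i. c i * d i j)" and "E \<equiv> (\<lambda>p q. \<Sum>\<^sub>\<infinity>i. c i * D i p q)"
  shows "g \<in> wiener1" and "E \<in> Fset"
    and "cqt_tendsto (\<lambda>k p q. \<Sum>i=-int k..int k. c i * smat_add (toeplitz (d i)) (D i) p q)
           (smat_add (toeplitz g) E)"
proof -
  have n: "0 \<le> wl1_norm wder (d i)" "0 \<le> Fnorm (D i)" for i
    by (simp_all add: wl1_norm_nonneg Fnorm_nonneg)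
  have 1: "(\<lambda>j. c i * d i j) \<in> wl1 wder" "wl1_norm wder (\<lambda>j. c i * d i j) \<le> norm (c i) * B i" for i
    using wl1_cmult[of "d i" wder "c i"] d[of i] le[of i] n[of i] unfolding wiener1_wl1
    by (auto intro!: mult_left_mono)
  have 2: "(\<lambda>x. c i * case_prod (D i) x) \<in> wl1 wone"
    "wl1_norm wone (\<lambda>x. c i * case_prod (D i) x) \<le> norm (c i) * B i" for i
    using wl1_cmult[of "case_prod (D i)" wone "c i"] D[of i] le[of i] n[of i] unfolding Fset_wl1
    by (auto intro!: mult_left_mono)
  note s1 = wl1_series_tendsto[OF _ 1 B, simplified]
  note s2 = wl1_series_tendsto[OF _ 2 B, simplified]
  show g: "g \<in> wiener1" unfolding wiener1_wl1 g_def by (rule s1)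
  have E': "case_prod E = (\<lambda>x. \<Sum>\<^sub>\<infinity>i. c i * case_prod (D i) x)"
    by (auto simp: E_def)
  show E: "E \<in> Fset" unfolding Fset_wl1 E' by (rule s2)
  define gd where "gd = (\<lambda>k j. (\<Sum>i=-int k..int k. c i * d i j) - g j)"
  define Ed where "Ed = (\<lambda>k p q. (\<Sum>i=-int k..int k. c i * D i p q) - E p q)"
  have gd: "gd k \<in> wl1 wder" "(\<lambda>k. wl1_norm wder (gd k)) \<longlonglongrightarrow> 0" for k
    unfolding gd_def g_def by (rule s1)+
  have Ed': "case_prod (Ed k) = (\<lambda>x. (\<Sum>i=-int k..int k. c i * case_prod (D i) x) - (\<Sum>\<^sub>\<infinity>i. c i * case_prod (D i) x))" for k
    by (auto simp: Ed_def E_def)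
  have Ed: "Ed k \<in> Fset" "(\<lambda>k. Fnorm (Ed k)) \<longlonglongrightarrow> 0" for k
    unfolding Fset_wl1 Ed' by (rule s2)+
  define X where "X = (\<lambda>k p q. \<Sum>i=-int k..int k. c i * smat_add (toeplitz (d i)) (D i) p q)"
  have X: "X k = smat_add (toeplitz (\<lambda>j. gd k j + g j)) (smat_add (Ed k) E)" for k
    by (auto simp: X_def gd_def Ed_def smat_add_def toeplitz_def fun_eq_iff algebra_simps sum.distrib)
  have "(\<lambda>j. gd k j + g j) \<in> wiener1" for k
    using g gd(1)[of k] unfolding wiener1_wl1 by (intro wl1_add) auto
  hence XC: "X k \<in> CQT" for k
    unfolding X CQT_def using Fset_add(1)[OF Ed(1) E] by blast
  have "smat_diff (X k) (smat_add (toeplitz g) E) = smat_add (toeplitz (gd k)) (Ed k)" for k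
    unfolding X by (auto simp: smat_diff_def smat_add_def toeplitz_def fun_eq_iff)
  hence "cqt_norm (smat_diff (X k) (smat_add (toeplitz g) E)) = wl1_norm wder (gd k) + Fnorm (Ed k)" for k
    by (simp add: cqt_norm_wl1 gd(1) Ed(1))
  hence "(\<lambda>k. cqt_norm (smat_diff (X k) (smat_add (toeplitz g) E))) \<longlonglongrightarrow> 0"
    using tendsto_add[OF gd(2) Ed(2)] by simp
  then show "cqt_tendsto (\<lambda>k p q. \<Sum>i=-int k..int k. c i * smat_add (toeplitz (d i)) (D i) p q)
           (smat_add (toeplitz g) E)"
    unfolding cqt_tendsto_def X_def[symmetric] using XC g E by (auto simp: CQT_def)
qed

section \<open>Evaluation of symbols on the unit circle\<close>

lemma norm_powi_unit: "norm (z::complex) = 1 \<Longrightarrow> norm (z powi i) = 1"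
  by (simp add: norm_power_int)

lemma wiener_shift:
  assumes "b \<in> wiener"
  shows "(\<lambda>i. norm (b (i - k))) summable_on UNIV"
    and "(\<Sum>\<^sub>\<infinity>i. norm (b (i - k))) = wiener_norm b"
  using assms summable_on_reindex_bij_betw[OF bij_shift(1), of "\<lambda>i. norm (b i)" k]
    infsum_reindex_bij_betw[OF bij_shift(1), of "\<lambda>i. norm (b i)" k]
  by (simp_all add: wiener_def wiener_norm_def)

text \<open>Powers of \<open>z\<close> have modulus 1, so Wiener norms dominate the double series.
  After the interchange, \<open>z powi i\<close> splits as
  \<open>z powi k * z powi (i - k)\<close>.\<close>

lemma symbol_conv:
  assumes a: "a \<in> wiener" and b: "b \<in> wiener" and z: "norm z = 1"
  shows "symbol (conv a b) z = symbol a z * symbol b z"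
proof -
  define u where "u = (\<lambda>k i. a k * b (i - k) * z powi i)"
  have z0: "z \<noteq> 0" using z by auto
  have n: "norm (u k i) = norm (a k) * norm (b (i - k))" for k i
    by (simp add: u_def norm_mult norm_powi_unit z)
  note sh = wiener_shift[OF b]
  have 1: "u k abs_summable_on UNIV" for k
    unfolding n by (rule summable_on_cmult_right[OF sh(1)])
  have 2: "(\<Sum>\<^sub>\<infinity>i. norm (u k i)) \<le> norm (a k) * wiener_norm b" for k
    unfolding n infsum_cmult_right' sh(2) by simp
  have B: "(\<lambda>k. norm (a k) * wiener_norm b) summable_on UNIV"
    using a by (intro summable_on_cmult_left) (simp add: wiener_def)
  have "(\<Sum>\<^sub>\<infinity>k. u k i) = conv a b i * z powi i" for i
    unfolding u_def conv_def by (rule infsum_cmult_left')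
  hence "symbol (conv a b) z = (\<Sum>\<^sub>\<infinity>i. \<Sum>\<^sub>\<infinity>k. u k i)"
    by (simp add: symbol_def)
  also have "\<dots> = (\<Sum>\<^sub>\<infinity>k. \<Sum>\<^sub>\<infinity>i. u k i)"
    by (rule abs_summable_family(5)[OF 1 2 B])
  also have "(\<lambda>k. \<Sum>\<^sub>\<infinity>i. u k i) = (\<lambda>k. a k * z powi k * symbol b z)"
  proof
    fix k
    have "u k i = (a k * z powi k) * (b (i - k) * z powi (i - k))" for i
      using z0 by (simp add: u_def power_int_diff)
    hence "(\<Sum>\<^sub>\<infinity>i. u k i) = (a k * z powi k) * (\<Sum>\<^sub>\<infinity>i. b (i - k) * z powi (i - k))"
      by (simp add: infsum_cmult_right')
    also have "(\<Sum>\<^sub>\<infinity>i. b (i - k) * z powi (i - k)) = symbol b z"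
      unfolding symbol_def by (rule infsum_reindex_bij_betw[OF bij_shift(1)])
    finally show "(\<Sum>\<^sub>\<infinity>i. u k i) = a k * z powi k * symbol b z" .
  qed
  finally show ?thesis
    by (simp add: infsum_cmult_left' symbol_def[of a])
qed

lemma symbol_delta0: "symbol delta0 z = 1"
proof -
  have "symbol delta0 z = infsum (\<lambda>i. delta0 i * z powi i) {0}"
    unfolding symbol_def by (rule infsum_cong_neutral) (auto simp: delta0_def)
  thus ?thesis by (simp add: delta0_def)
qed

lemma symbol_conv_power:
  assumes a: "a \<in> wiener" and z: "norm z = 1"
  shows "symbol (conv_power a n) z = symbol a z ^ n"
proof (induction n)
  case (Suc n)
  have "conv_power a n \<in> wiener"
    using a weight.wl1_conv_power(1)[OF weight_one] by (simp add: wiener_wl1)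
  then show ?case using Suc a z by (simp add: symbol_conv)
qed (simp add: symbol_delta0)

text \<open>Evaluation at a point of the circle is bounded for the Wiener norm, so it passes through
  a normwise convergent series.\<close>

lemma symbol_series:
  assumes d: "\<And>n. d n \<in> wiener" and B: "(\<lambda>n. norm (c n) * wiener_norm (d n)) summable_on UNIV"
    and z: "norm z = 1"
  shows "symbol (\<lambda>j. \<Sum>\<^sub>\<infinity>n. c n * d n j) z = (\<Sum>\<^sub>\<infinity>n. c n * symbol (d n) z)"
proof -
  define u where "u = (\<lambda>n i. c n * d n i * z powi i)"
  have n: "norm (u k i) = norm (c k) * norm (d k i)" for k i
    by (simp add: u_def norm_mult norm_powi_unit z)
  have 1: "u k abs_summable_on UNIV" for k
    unfolding n using d[of k] by (intro summable_on_cmult_right) (simp add: wiener_def)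
  have 2: "(\<Sum>\<^sub>\<infinity>i. norm (u k i)) \<le> norm (c k) * wiener_norm (d k)" for k
    unfolding n infsum_cmult_right' wiener_norm_def by simp
  have "(\<Sum>\<^sub>\<infinity>k. u k i) = (\<Sum>\<^sub>\<infinity>n. c n * d n i) * z powi i" for i
    unfolding u_def by (rule infsum_cmult_left')
  hence "symbol (\<lambda>j. \<Sum>\<^sub>\<infinity>n. c n * d n j) z = (\<Sum>\<^sub>\<infinity>i. \<Sum>\<^sub>\<infinity>k. u k i)"
    by (simp add: symbol_def)
  also have "\<dots> = (\<Sum>\<^sub>\<infinity>k. \<Sum>\<^sub>\<infinity>i. u k i)"
    by (rule abs_summable_family(5)[OF 1 2 B])
  also have "(\<lambda>k. \<Sum>\<^sub>\<infinity>i. u k i) = (\<lambda>k. c k * symbol (d k) z)"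
    by (simp add: u_def symbol_def mult.assoc infsum_cmult_right')
  finally show ?thesis .
qed

section \<open>Decay of Laurent coefficients\<close>

lemma analytic_laurent_abs_summable:
  assumes "analytic_laurent f c r R" and "r < ereal x" and "ereal x < R" and "0 \<le> x"
  shows "(\<lambda>i. norm (c i) * x powi i) summable_on UNIV"
proof -
  have "complex_of_real x \<in> annulus r R" using assms by (simp add: annulus_def)
  hence "(\<lambda>i. c i * complex_of_real x powi i) summable_on UNIV"
    using assms(1) unfolding analytic_laurent_def summable_on_def by blast
  hence "(\<lambda>i. c i * complex_of_real x powi i) abs_summable_on UNIV"
    by (simp only: summable_on_iff_abs_summable_on_complex)
  thus ?thesis using assms(4) by (simp add: norm_mult norm_power_int)
qed

text \<open>Two radii \<open>x\<close> and \<open>y\<close> inside the annulus are chosen with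
  \<open>t \<le> x\<close> and \<open>s \<le> 1 / y\<close>. The nonnegative powers are dominated at
  radius \<open>x\<close> and the negative ones at radius \<open>y\<close>, where the series
  converges absolutely.\<close>

lemma laurent_coeff_summable:
  assumes an: "analytic_laurent f c r R" and r: "0 \<le> r" "r < R"
    and t: "0 \<le> t" "ereal t < R" and s: "0 \<le> s" "ereal s < inverse r"
  shows "(\<lambda>i. norm (c i) * (if 0 \<le> i then t ^ nat i else s ^ nat (- i))) summable_on UNIV"
proof -
  have "max r (ereal t) < R" using r t by simp
  then obtain x where x: "max r (ereal t) < ereal x" "ereal x < R"
    using ereal_dense2 by blast
  \<comment> \<open>For \<open>s = 0\<close> any radius in the annulus will do; this case is
    separate because \<open>1 / s\<close> would then be 0.\<close>
  have "\<exists>y. r < ereal y \<and> ereal y < R \<and> s * y \<le> 1"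
  proof (cases "s = 0")
    case True
    then show ?thesis using ereal_dense2[OF r(2)] by auto
  next
    case False
    with s have s0: "0 < s" by simp
    have "r < ereal (1 / s)"
    proof (cases r)
      case (real r')
      show ?thesis
      proof (cases "r' = 0")
        case True
        then show ?thesis using s0 real by simp
      next
        case False
        then have "s < 1 / r'" "0 < r'" using s(2) r(1) real by (auto simp: field_simps)
        then show ?thesis using s0 real by (simp add: field_simps)
      qed
    qed (use r in auto)
    then have "r < min R (ereal (1 / s))" using r by simp
    then obtain y where "r < ereal y" "ereal y < min R (ereal (1 / s))"
      using ereal_dense2 by blast
    then show ?thesis using s0 by (intro exI[of _ y]) (auto simp: field_simps)
  qed
  then obtain y where y: "r < ereal y" "ereal y < R" "s * y \<le> 1" by blast
  have pos: "0 < x" "0 < y" using x(1) y(1) r(1)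
    by (auto simp: zero_ereal_def dest: le_less_trans)
  have tx: "t \<le> x" using x(1) by simp
  have sy: "s \<le> inverse y" using y(3) pos by (simp add: field_simps)
  have S: "(\<lambda>i. norm (c i) * x powi i + norm (c i) * y powi i) summable_on UNIV"
    by (intro summable_on_add analytic_laurent_abs_summable[OF an]) (use x y pos in auto)
  show ?thesis
  proof (rule summable_on_comparison_test[OF S])
    fix i :: int
    have "(if 0 \<le> i then t ^ nat i else s ^ nat (- i)) \<le> x powi i + y powi i"
    proof (cases "0 \<le> i")
      case True
      then have "t ^ nat i \<le> x powi i"
        using power_mono[OF tx t(1)] by (simp add: power_int_def)
      then show ?thesis using True zero_le_power_int[of y i] pos by (simp add: add_increasing2)
    next
      case False
      then have "s ^ nat (- i) \<le> y powi i"
        using power_mono[OF sy s(1)] by (simp add: power_int_def)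
      then show ?thesis using False zero_le_power_int[of x i] pos by (simp add: add_increasing)
    qed
    from mult_left_mono[OF this, of "norm (c i)"]
    show "norm (c i) * (if 0 \<le> i then t ^ nat i else s ^ nat (- i)) \<le> norm (c i) * x powi i + norm (c i) * y powi i"
      by (simp add: algebra_simps)
  qed (use t s in auto)
qed

section \<open>Symbols analytic near the unit circle\<close>

abbreviation "wpow \<rho> \<equiv> (\<lambda>i::int. (\<rho>::real) ^ nat \<bar>i\<bar>)"

lemma wl1_wpow_mono:
  assumes "a \<in> wl1 (wpow \<rho>)" and "1 \<le> \<sigma>" and "\<sigma> \<le> \<rho>"
  shows "a \<in> wl1 (wpow \<sigma>)" and "wl1_norm (wpow \<sigma>) a \<le> wl1_norm (wpow \<rho>) a"
  using wl1_mono[OF assms(1), of "wpow \<sigma>"] power_mono[of \<sigma> \<rho>] assms(2,3) by auto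

text \<open>Convexity of the power function on the nonnegative reals, between the points
  \<open>1\<close> and \<open>x\<close>.\<close>

lemma power_interpolation_le:
  fixes x \<theta> :: real
  assumes "1 \<le> x" and "0 \<le> \<theta>" and "\<theta> \<le> 1"
  shows "(1 + \<theta> * (x - 1)) ^ n \<le> (1 - \<theta>) + \<theta> * x ^ n"
proof -
  have "convex_on {0::real..} (\<lambda>x. x ^ n)"
    using convex_power_odd[of n] convex_on_subset[OF convex_power_even[of n]] by (cases "even n") auto
  from convex_onD[OF this assms(2,3), of 1 x] show ?thesis
    using assms by (simp add: algebra_simps)
qed

text \<open>The norm is continuous from the right at radius 1: by convexity its value at
  \<open>\<sigma> = 1 + \<theta> * (\<rho> - 1)\<close> is at most the interpolation between the
  Wiener norm and the norm at radius \<open>\<rho>\<close>.\<close>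

lemma wl1_wpow_near_one:
  assumes a: "a \<in> wl1 (wpow \<rho>)" and \<rho>: "1 < \<rho>" and K: "wiener_norm a < K"
  obtains \<sigma> where "1 < \<sigma>" and "\<sigma> \<le> \<rho>" and "wl1_norm (wpow \<sigma>) a < K"
proof -
  interpret weight "wpow \<rho>" by (rule weight_power) (use \<rho> in simp)
  have aw: "a \<in> wiener" using wl1_subset_wiener(1)[OF a] by (simp add: wiener_wl1)
  define N0 N1 where "N0 = wl1_norm (wpow \<rho>) a" and "N1 = wiener_norm a"
  have N0: "0 \<le> N0" unfolding N0_def by (rule wl1_norm_nonneg) (rule nonneg)
  have N1: "0 \<le> N1" by (simp add: N1_def wiener_norm_nonneg)
  \<comment> \<open>Small enough that \<open>\<theta> * N0\<close> stays below the gap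
    \<open>K - N1\<close>. Adding 1 keeps the denominator positive, and the minimum keeps
    \<open>\<sigma> \<le> \<rho>\<close>.\<close>
  define \<theta> where "\<theta> = min 1 ((K - N1) / (N0 + 1))"
  have \<theta>: "0 < \<theta>" "\<theta> \<le> 1" using K N0 by (auto simp: \<theta>_def N1_def)
  have "\<theta> * N0 < \<theta> * (N0 + 1)" using \<theta> by simp
  also have "\<dots> \<le> (K - N1) / (N0 + 1) * (N0 + 1)"
    using N0 by (intro mult_right_mono) (auto simp: \<theta>_def)
  also have "\<dots> = K - N1" using N0 by simp
  finally have lt: "\<theta> * N0 < K - N1" .
  define \<sigma> where "\<sigma> = 1 + \<theta> * (\<rho> - 1)"
  have "\<theta> * (\<rho> - 1) \<le> 1 * (\<rho> - 1)" "0 < \<theta> * (\<rho> - 1)"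
    using \<theta> \<rho> by (auto intro: mult_right_mono)
  then have \<sigma>: "1 < \<sigma>" "\<sigma> \<le> \<rho>" unfolding \<sigma>_def mult_1_left by linarith+
  have s: "(\<lambda>i. norm (a i)) summable_on UNIV" "(\<lambda>i. wpow \<rho> i * norm (a i)) summable_on UNIV"
    using a aw by (auto simp: wl1_def wiener_def)
  have s': "(\<lambda>i. (1 - \<theta>) * norm (a i) + \<theta> * (wpow \<rho> i * norm (a i))) summable_on UNIV"
    by (intro summable_on_add summable_on_cmult_right s)
  have "wl1_norm (wpow \<sigma>) a \<le> (\<Sum>\<^sub>\<infinity>i. (1 - \<theta>) * norm (a i) + \<theta> * (wpow \<rho> i * norm (a i)))"
    unfolding wl1_norm_def
  proof (rule infsum_mono[OF _ s'])
    show "(\<lambda>i. wpow \<sigma> i * norm (a i)) summable_on UNIV"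
      using wl1_wpow_mono(1)[OF a _ \<sigma>(2)] \<sigma>(1) by (simp add: wl1_def)
    show "wpow \<sigma> i * norm (a i) \<le> (1 - \<theta>) * norm (a i) + \<theta> * (wpow \<rho> i * norm (a i))" for i
      using mult_right_mono[OF power_interpolation_le[of \<rho> \<theta> "nat \<bar>i\<bar>"], of "norm (a i)"] \<rho> \<theta>
      by (simp add: \<sigma>_def algebra_simps)
  qed
  also have "\<dots> = (1 - \<theta>) * N1 + \<theta> * N0"
    by (subst infsum_add)
       (auto simp: N0_def N1_def wl1_norm_def wiener_norm_def infsum_cmult_right' intro!: summable_on_cmult_right s)
  also have "\<dots> = N1 - \<theta> * N1 + \<theta> * N0" by (simp add: left_diff_distrib)
  also have "\<dots> < K" using lt mult_nonneg_nonneg[OF less_imp_le[OF \<theta>(1)] N1] by linarith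
  finally show ?thesis using that \<sigma> by blast
qed

text \<open>The annulus contains a circle of radius \<open>t > 1\<close> and one of radius
  \<open>1 / s < 1\<close>; they control the nonnegative and the negative coefficients, and
  \<open>min t s\<close> serves both sides.\<close>

lemma analytic_laurent_imp_wl1:
  assumes an: "analytic_laurent h a r R" and r: "0 \<le> r" "r < 1" "1 < R"
  obtains \<rho> where "1 < \<rho>" and "a \<in> wl1 (wpow \<rho>)"
proof -
  obtain t where t: "1 < ereal t" "ereal t < R" using ereal_dense2[OF r(3)] by blast
  have "1 < inverse r"
  proof (cases r)
    case (real x)
    then show ?thesis using r(1,2) by (cases "x = 0") (auto simp: field_simps)
  qed (use r in auto)
  then obtain s where s: "1 < ereal s" "ereal s < inverse r" using ereal_dense2 by blast
  have ts: "1 < t" "1 < s" using t s by auto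
  have "r < R" using r by (metis less_trans)
  from laurent_coeff_summable[OF an r(1) this _ t(2) _ s(2)] ts
  have S: "(\<lambda>i. norm (a i) * (if 0 \<le> i then t ^ nat i else s ^ nat (- i))) summable_on UNIV" by simp
  have "a \<in> wl1 (wpow (min t s))"
    unfolding wl1_def mem_Collect_eq
  proof (rule summable_on_comparison_test[OF S])
    fix i
    have "wpow (min t s) i \<le> (if 0 \<le> i then t ^ nat i else s ^ nat (- i))"
      using ts by (auto intro!: power_mono)
    from mult_right_mono[OF this, of "norm (a i)"]
    show "wpow (min t s) i * norm (a i) \<le> norm (a i) * (if 0 \<le> i then t ^ nat i else s ^ nat (- i))"
      by (simp add: mult.commute)
  qed (use ts in auto)
  then show ?thesis using that[of "min t s"] ts by simp
qed

section \<open>Inverses under convolution inherit geometric decay\<close>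

lemma conv_diff_right:
  assumes "a \<in> wiener" and "b \<in> wiener" and "c \<in> wiener"
  shows "conv a (\<lambda>i. b i - c i) = (\<lambda>i. conv a b i - conv a c i)"
proof
  fix i
  note s = abs_summable_summable[OF conv_abs_summable[OF assms(1,2), of i]]
    abs_summable_summable[OF conv_abs_summable[OF assms(1,3), of i]]
  have "(\<Sum>\<^sub>\<infinity>k. a k * b (i - k) + - (a k * c (i - k))) = conv a b i + - conv a c i"
    unfolding conv_def infsum_uminus[symmetric] using s by (intro infsum_add) (auto simp: summable_on_uminus)
  then show "conv a (\<lambda>i. b i - c i) i = conv a b i - conv a c i"
    by (simp add: conv_def algebra_simps)
qed

lemma conv_delta0: "conv delta0 a = a" "conv a delta0 = a"
proof -
  show "conv delta0 a = a"
  proof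
    fix i
    have "conv delta0 a i = infsum (\<lambda>k. delta0 k * a (i - k)) {0}"
      unfolding conv_def by (rule infsum_cong_neutral) (auto simp: delta0_def)
    then show "conv delta0 a i = a i" by (simp add: delta0_def)
  qed
  show "conv a delta0 = a"
  proof
    fix i
    have "conv a delta0 i = infsum (\<lambda>k. a k * delta0 (i - k)) {i}"
      unfolding conv_def by (rule infsum_cong_neutral) (auto simp: delta0_def)
    then show "conv a delta0 i = a i" by (simp add: delta0_def)
  qed
qed

lemma conv_assoc:
  assumes a: "a \<in> wiener" and b: "b \<in> wiener" and c: "c \<in> wiener"
  shows "conv (conv a b) c = conv a (conv b c)"
proof
  fix i
  define u where "u = (\<lambda>k j. a k * b (j - k) * c (i - j))"
  note sh = wiener_shift[OF b]
  have le: "norm (u k j) \<le> norm (a k) * wiener_norm c * norm (b (j - k))" for k j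
    using mult_left_mono[OF wiener_bound[OF c, of "i - j"], of "norm (a k) * norm (b (j - k))"]
    by (simp add: u_def norm_mult mult_ac)
  have s: "(\<lambda>j. norm (a k) * wiener_norm c * norm (b (j - k))) summable_on UNIV" for k
    by (rule summable_on_cmult_right[OF sh(1)])
  have 1: "u k abs_summable_on UNIV" for k
    by (rule summable_on_comparison_test[OF s[of k]]) (use le in auto)
  have 2: "(\<Sum>\<^sub>\<infinity>j. norm (u k j)) \<le> norm (a k) * wiener_norm c * wiener_norm b" for k
    using infsum_mono[OF 1 s le] by (simp add: infsum_cmult_right' sh(2))
  have B: "(\<lambda>k. norm (a k) * wiener_norm c * wiener_norm b) summable_on UNIV"
    using a by (intro summable_on_cmult_left) (simp add: wiener_def)
  have "conv (conv a b) c i = (\<Sum>\<^sub>\<infinity>j. \<Sum>\<^sub>\<infinity>k. u k j)"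
    by (simp add: conv_def u_def infsum_cmult_left')
  also have "\<dots> = (\<Sum>\<^sub>\<infinity>k. \<Sum>\<^sub>\<infinity>j. u k j)"
    by (rule abs_summable_family(5)[OF 1 2 B])
  also have "(\<lambda>k. \<Sum>\<^sub>\<infinity>j. u k j) = (\<lambda>k. a k * conv b c (i - k))"
  proof
    fix k
    have "(\<Sum>\<^sub>\<infinity>j. u k j) = a k * (\<Sum>\<^sub>\<infinity>j. b (j - k) * c ((i - k) - (j - k)))"
      by (simp add: u_def mult.assoc infsum_cmult_right')
    also have "(\<Sum>\<^sub>\<infinity>j. b (j - k) * c ((i - k) - (j - k))) = conv b c (i - k)"
      unfolding conv_def by (rule infsum_reindex_bij_betw[OF bij_shift(1)])
    finally show "(\<Sum>\<^sub>\<infinity>j. u k j) = a k * conv b c (i - k)" .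
  qed
  finally show "conv (conv a b) c i = conv a (conv b c) i"
    by (simp only: conv_def[of a "conv b c"])
qed

lemma wiener_finite_approximation:
  assumes b: "b \<in> wiener" and "0 < \<epsilon>"
  obtains F where "finite F" and "wiener_norm (\<lambda>i. b i - (if i \<in> F then b i else 0)) < \<epsilon>"
proof -
  have s: "(\<lambda>i. norm (b i)) summable_on UNIV" using b by (simp add: wiener_def)
  from infsum_finite_approximation[OF s, of "\<epsilon> / 2"] assms(2)
  obtain F where F: "finite F" "dist (\<Sum>i\<in>F. norm (b i)) (\<Sum>\<^sub>\<infinity>i. norm (b i)) \<le> \<epsilon> / 2"
    by auto
  have "wiener_norm (\<lambda>i. b i - (if i \<in> F then b i else 0)) = (\<Sum>\<^sub>\<infinity>i\<in>- F. norm (b i))"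
    unfolding wiener_norm_def by (rule infsum_cong_neutral) auto
  moreover have "(\<Sum>\<^sub>\<infinity>i\<in>F \<union> - F. norm (b i)) = (\<Sum>\<^sub>\<infinity>i\<in>F. norm (b i)) + (\<Sum>\<^sub>\<infinity>i\<in>- F. norm (b i))"
    by (rule infsum_Un_disjoint) (auto intro: summable_on_subset_banach[OF s])
  ultimately have "wiener_norm (\<lambda>i. b i - (if i \<in> F then b i else 0)) < \<epsilon>"
    using F assms(2) by (simp add: dist_real_def)
  with F(1) show ?thesis by (rule that)
qed

text \<open>With \<open>F\<close> finite and \<open>b\<^sub>F\<close> the truncation of \<open>b\<close> to \<open>F\<close>, the element
  \<open>e = 1 - a b\<^sub>F\<close> is small and \<open>b = b\<^sub>F + b e\<close>. Taking norms in this identity bounds the norm of \<open>b\<close>,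
  provided that norm is known to be finite, hence the detour through truncated weights.\<close>

lemma wl1_wpow_inverse:
  assumes a: "a \<in> wl1 (wpow \<rho>)" and \<rho>: "1 < \<rho>" and b: "b \<in> wiener"
    and ab: "conv a b = delta0" and ba: "conv b a = delta0"
  obtains \<sigma> where "1 < \<sigma>" and "b \<in> wl1 (wpow \<sigma>)"
proof -
  interpret W: weight "wpow \<rho>" by (rule weight_power) (use \<rho> in simp)
  have aw: "a \<in> wiener" using W.wl1_subset_wiener(1)[OF a] by (simp add: wiener_wl1)
  \<comment> \<open>This accuracy makes \<open>e = a (b - bF)\<close> have Wiener norm below
    1.\<close>
  have "0 < 1 / (wiener_norm a + 1)"
    using wiener_norm_nonneg[of a] by simp
  from wiener_finite_approximation[OF b this] obtain F where
    F: "finite F" "wiener_norm (\<lambda>i. b i - (if i \<in> F then b i else 0)) < 1 / (wiener_norm a + 1)" by blast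
  define bF where "bF = (\<lambda>i. if i \<in> F then b i else 0)"
  define e where "e = (\<lambda>i. delta0 i - conv a bF i)"
  have bF: "bF \<in> wl1 w" for w
    by (rule wl1_finite_support, rule finite_subset[OF _ F(1)]) (auto simp: bF_def)
  have bFw: "bF \<in> wiener" by (simp add: wiener_wl1 bF)
  have bd: "(\<lambda>i. b i - bF i) \<in> wiener"
    using b bFw unfolding wiener_wl1 by (intro wl1_diff) auto
  have "e = conv a (\<lambda>i. b i - bF i)"
    unfolding e_def conv_diff_right[OF aw b bFw] ab by (rule refl)
  hence "wiener_norm e \<le> wiener_norm a * wiener_norm (\<lambda>i. b i - bF i)"
    using weight.wl1_conv_weight(2)[OF weight_one, of a "\<lambda>i. b i - bF i"] aw bd by (simp add: wiener_wl1)
  also have "\<dots> \<le> wiener_norm a * (1 / (wiener_norm a + 1))"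
    using F(2) by (intro mult_left_mono wiener_norm_nonneg) (simp add: bF_def)
  also have "\<dots> < 1" using wiener_norm_nonneg[of a] by simp
  finally have e1: "wiener_norm e < 1" .
  have e\<rho>: "e \<in> wl1 (wpow \<rho>)"
    unfolding e_def by (intro wl1_diff W.wl1_delta0 W.wl1_conv_weight a bF W.nonneg)
  from wl1_wpow_near_one[OF this \<rho> e1] obtain \<sigma> where
    \<sigma>: "1 < \<sigma>" "\<sigma> \<le> \<rho>" "wl1_norm (wpow \<sigma>) e < 1" by blast
  interpret S: weight "wpow \<sigma>" by (rule weight_power) (use \<sigma> in simp)
  have e\<sigma>: "e \<in> wl1 (wpow \<sigma>)" using wl1_wpow_mono(1)[OF e\<rho>] \<sigma> by simp
  have cw: "conv a bF \<in> wiener"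
    unfolding wiener_wl1 by (intro weight.wl1_conv_weight[OF weight_one] bF aw[unfolded wiener_wl1])
  have dw: "delta0 \<in> wiener" unfolding wiener_wl1 by (rule weight.wl1_delta0[OF weight_one])
  have "conv b e = (\<lambda>i. b i - bF i)"
    unfolding e_def conv_diff_right[OF b dw cw] conv_delta0 conv_assoc[OF b aw bFw, symmetric] ba
    by (rule refl)
  hence fp: "b = (\<lambda>i. bF i + conv b e i)" by simp
  define p q where "p = wl1_norm (wpow \<sigma>) bF" and "q = wl1_norm (wpow \<sigma>) e"
  \<comment> \<open>For truncated weights the norm \<open>x\<close> of \<open>b\<close> is finite,
    so \<open>x \<le> p + x * q\<close> with \<open>q < 1\<close> can be solved for
    \<open>x\<close>; the resulting bound does not involve \<open>M\<close>.\<close>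
  have bound: "wl1_norm (\<lambda>i. min (wpow \<sigma> i) M) b \<le> p / (1 - q)" and
    mem: "b \<in> wl1 (\<lambda>i. min (wpow \<sigma> i) M)" if M: "1 \<le> M" for M
  proof -
    interpret T: weight "\<lambda>i. min (wpow \<sigma> i) M" by (rule S.weight_min[OF M])
    have "b \<in> wl1 (\<lambda>_. M)"
      using b by (auto simp: wl1_def wiener_def intro: summable_on_cmult_right)
    then show m: "b \<in> wl1 (\<lambda>i. min (wpow \<sigma> i) M)"
      using T.nonneg by (rule wl1_mono(1)) simp
    have le: "c \<in> wl1 (\<lambda>i. min (wpow \<sigma> i) M)" "wl1_norm (\<lambda>i. min (wpow \<sigma> i) M) c \<le> wl1_norm (wpow \<sigma>) c"
      if "c \<in> wl1 (wpow \<sigma>)" for c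
      using wl1_mono[OF that T.nonneg] by auto
    have "wl1_norm (\<lambda>i. min (wpow \<sigma> i) M) b
        \<le> wl1_norm (\<lambda>i. min (wpow \<sigma> i) M) bF + wl1_norm (\<lambda>i. min (wpow \<sigma> i) M) (conv b e)"
      by (subst fp, rule wl1_add[OF T.nonneg]) (intro bF T.wl1_conv_weight m le e\<sigma>)+
    also have "\<dots> \<le> p + wl1_norm (\<lambda>i. min (wpow \<sigma> i) M) b * wl1_norm (\<lambda>i. min (wpow \<sigma> i) M) e"
      unfolding p_def by (intro add_mono le bF T.wl1_conv_weight m e\<sigma>)
    also have "\<dots> \<le> p + wl1_norm (\<lambda>i. min (wpow \<sigma> i) M) b * q"
      unfolding q_def by (intro add_mono mult_left_mono le e\<sigma> wl1_norm_nonneg T.nonneg order_refl)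
    finally show "wl1_norm (\<lambda>i. min (wpow \<sigma> i) M) b \<le> p / (1 - q)"
      using \<sigma>(3) by (simp add: q_def field_simps)
  qed
  have "b \<in> wl1 (wpow \<sigma>)"
    unfolding wl1_def mem_Collect_eq
  proof (rule nonneg_bdd_above_summable_on)
    show "bdd_above (sum (\<lambda>i. wpow \<sigma> i * norm (b i)) ` {X. X \<subseteq> UNIV \<and> finite X})"
    proof (rule bdd_aboveI2)
      fix X :: "int set" assume "X \<in> {X. X \<subseteq> UNIV \<and> finite X}"
      then have X: "finite X" by simp
      \<comment> \<open>\<open>M\<close> exceeds all weights on the finite set \<open>X\<close>,
        where truncation therefore changes nothing.\<close>
      define M where "M = 1 + (\<Sum>i\<in>X. wpow \<sigma> i)"
      have M: "1 \<le> M" using S.nonneg by (simp add: M_def sum_nonneg)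
      have "wpow \<sigma> i \<le> M" if "i \<in> X" for i
        using member_le_sum[of i X "wpow \<sigma>"] that X S.nonneg by (simp add: M_def)
      then have "(\<Sum>i\<in>X. wpow \<sigma> i * norm (b i)) = (\<Sum>i\<in>X. min (wpow \<sigma> i) M * norm (b i))"
        by (intro sum.cong) (simp_all add: min_def)
      also have "\<dots> \<le> wl1_norm (\<lambda>i. min (wpow \<sigma> i) M) b"
        unfolding wl1_norm_def using mem[OF M] X M S.nonneg
        by (intro finite_sum_le_infsum) (auto simp: wl1_def)
      also have "\<dots> \<le> p / (1 - q)" by (rule bound[OF M])
      finally show "(\<Sum>i\<in>X. wpow \<sigma> i * norm (b i)) \<le> p / (1 - q)" .
    qed
  qed (use \<sigma> in simp)
  with \<sigma>(1) show ?thesis by (rule that)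
qed

text \<open>On this annulus \<open>norm (z powi i)\<close> is at most \<open>wpow \<rho> i\<close>,
  so the M-test gives uniform convergence, and uniform limits of holomorphic finite sums are
  holomorphic.\<close>

lemma analytic_laurent_symbol:
  assumes g: "g \<in> wl1 (wpow \<rho>)" and \<rho>: "1 < \<rho>"
  shows "analytic_laurent (symbol g) g (ereal (1 / \<rho>)) (ereal \<rho>)"
proof -
  define A where "A = annulus (ereal (1 / \<rho>)) (ereal \<rho>)"
  have A: "A = {z. 1 / \<rho> < norm z} \<inter> {z. norm z < \<rho>}" by (auto simp: A_def annulus_def)
  have op: "open A"
    unfolding A by (intro open_Int open_Collect_less continuous_intros)
  have le: "norm (g i * z powi i) \<le> wpow \<rho> i * norm (g i)" if "z \<in> A" for i z
  proof -
    have z: "1 / \<rho> < norm z" "norm z < \<rho>" using that by (auto simp: A)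
    have "0 < 1 / \<rho>" using \<rho> by simp
    then have "0 < norm z" using z(1) by (rule less_trans)
    then have inv: "inverse (norm z) \<le> \<rho>" using z(1) \<rho> by (simp add: field_simps)
    have "norm (z powi i) \<le> wpow \<rho> i"
    proof (cases "0 \<le> i")
      case True
      then show ?thesis
        using power_mono[OF less_imp_le[OF z(2)], of "nat i"] by (simp add: power_int_def norm_power)
    next
      case False
      then show ?thesis
        using power_mono[OF inv, of "nat (- i)"] by (simp add: power_int_def norm_power norm_inverse)
    qed
    then show ?thesis by (simp add: norm_mult mult_left_mono mult.commute)
  qed
  have s: "(\<lambda>i. wpow \<rho> i * norm (g i)) summable_on UNIV" using g by (simp add: wl1_def)
  have lim: "uniform_limit A (\<lambda>X z. \<Sum>i\<in>X. g i * z powi i) (symbol g) (finite_subsets_at_top UNIV)"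
    unfolding symbol_def[abs_def] by (rule Weierstrass_m_test_general[OF _ s]) (rule le)
  have z0: "0 \<notin> A" using \<rho> by (auto simp: A)
  have "symbol g analytic_on {z}" if zA: "z \<in> A" for z
  proof -
    obtain d where d: "0 < d" "cball z d \<subseteq> A"
      using op zA unfolding open_contains_cball by blast
    have ho: "(\<lambda>z. \<Sum>i\<in>X. g i * z powi i) holomorphic_on A" for X
      using z0 by (intro holomorphic_intros) auto
    have "\<forall>\<^sub>F X in finite_subsets_at_top UNIV. continuous_on (cball z d) (\<lambda>z. \<Sum>i\<in>X. g i * z powi i)
            \<and> (\<lambda>z. \<Sum>i\<in>X. g i * z powi i) holomorphic_on ball z d"
      by (intro always_eventually allI conjI holomorphic_on_imp_continuous_on
            holomorphic_on_subset[OF ho d(2)] holomorphic_on_subset[OF ho order_trans[OF ball_subset_cball d(2)]])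
    from holomorphic_uniform_limit[OF this uniform_limit_on_subset[OF lim d(2)] finite_subsets_at_top_neq_bot]
    have "symbol g holomorphic_on ball z d" .
    then show ?thesis using d(1) unfolding analytic_at by (metis centre_in_ball open_ball)
  qed
  then have an: "symbol g analytic_on A" using analytic_on_analytic_at by metis
  have "((\<lambda>i. g i * z powi i) has_sum symbol g z) UNIV" if "z \<in> A" for z
  proof -
    have "(\<lambda>i. g i * z powi i) abs_summable_on UNIV"
      by (rule summable_on_comparison_test[OF s]) (use le[OF that] in auto)
    from has_sum_infsum[OF abs_summable_summable[OF this]] show ?thesis by (simp add: symbol_def)
  qed
  with an show ?thesis unfolding analytic_laurent_def A_def by (intro conjI ballI)
qed

section \<open>Functions of quasi-Toeplitz matrices: convergence, symbol and analyticity\<close>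

theorem theorem3p4:
  fixes f :: "complex \<Rightarrow> complex" and c :: "int \<Rightarrow> complex" and r R :: ereal
    and a :: "int \<Rightarrow> complex" and Ea A Ainv :: smat
  assumes "0 \<le> r" and "r < R"
    and "analytic_laurent f c r R"
    and "a \<in> wiener1" and "Ea \<in> Fset" and "A = smat_add (toeplitz a) Ea"
    and "symbol a ` sphere 0 1 \<subseteq> annulus r R"
    and "is_cqt_inverse A Ainv"
    and "ereal (cqt_norm Ainv) < inverse r"
    and "ereal (cqt_norm A) < R"
  shows "\<exists>fA g E. cqt_tendsto (laurent_partial_sum c A Ainv) fA
           \<and> g \<in> wiener1 \<and> (\<forall>z\<in>sphere 0 1. symbol g z = f (symbol a z))
           \<and> E \<in> Fset \<and> fA = smat_add (toeplitz g) E
           \<and> (A \<in> AQT \<longrightarrow> fA \<in> AQT)"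
proof -
  obtain b Eb where b: "b \<in> wiener1" "Eb \<in> Fset" "Ainv = smat_add (toeplitz b) Eb"
    using assms(8) unfolding is_cqt_inverse_def CQT_def by blast
  note a = assms(4,5,6)
  have aw: "a \<in> wiener" and bw: "b \<in> wiener" using a b by (simp_all add: wiener1_def)
  have ab: "conv a b = delta0" and ba: "conv b a = delta0"
    using assms(8) cqt_inverse_conv[OF a(1) b(1) a(2) b(2)] cqt_inverse_conv[OF b(1) a(1) b(2) a(2)]
    unfolding is_cqt_inverse_def a(3) b(3) by simp_all
  define t s where "t = cqt_norm A" and "s = cqt_norm Ainv"
  have t: "t = wl1_norm wder a + Fnorm Ea" and s: "s = wl1_norm wder b + Fnorm Eb"
    unfolding t_def s_def a(3) b(3) using a(1,2) b(1,2) by (simp_all add: cqt_norm_wl1 wiener1_wl1)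
  have at: "wl1_norm wder a \<le> t" and bs: "wl1_norm wder b \<le> s"
    by (simp_all add: t s Fnorm_nonneg)
  have ts: "0 \<le> t" "0 \<le> s"
    by (simp_all add: t s Fnorm_nonneg wl1_norm_nonneg)
  \<comment> \<open>\<open>d i\<close> will be the symbol of the \<open>i\<close>-th power of
    \<open>A\<close>, and \<open>B i\<close> a joint bound for it and its correction. The two norm
    hypotheses make the series with terms \<open>norm (c i) * B i\<close> converge.\<close>
  define d where "d = (\<lambda>i. if 0 \<le> i then conv_power a (nat i) else conv_power b (nat (- i)))"
  define B where "B = (\<lambda>i. if 0 \<le> i then t ^ nat i else s ^ nat (- i))"
  have cB: "(\<lambda>i. norm (c i) * B i) summable_on UNIV"
    unfolding B_def using assms ts by (intro laurent_coeff_summable) (auto simp: t_def s_def)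
  have "\<exists>G. G \<in> Fset \<and> smat_powi A Ainv i = smat_add (toeplitz (d i)) G
      \<and> wl1_norm wder (d i) + Fnorm G \<le> B i" for i
    unfolding smat_powi_def d_def B_def t s
    using cqt_power[OF a(1,2), of "nat i"] cqt_power[OF b(1,2), of "nat (- i)"] a(3) b(3) by auto
  then obtain D where D: "\<And>i. D i \<in> Fset" "\<And>i. smat_powi A Ainv i = smat_add (toeplitz (d i)) (D i)"
    "\<And>i. wl1_norm wder (d i) + Fnorm (D i) \<le> B i" by metis
  have d: "d i \<in> wiener1" for i
    using wder.wl1_conv_power(1) a(1) b(1) by (simp add: d_def wiener1_wl1)
  define g where "g = (\<lambda>j. \<Sum>\<^sub>\<infinity>i. c i * d i j)"
  define E where "E = (\<lambda>p q. \<Sum>\<^sub>\<infinity>i. c i * D i p q)"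
  note ser = cqt_series[of d D B c, OF d D(1) D(3) cB, folded g_def E_def]
  have conv: "cqt_tendsto (laurent_partial_sum c A Ainv) (smat_add (toeplitz g) E)"
    using ser(3) unfolding laurent_partial_sum_def[abs_def] D(2) .
  have sym: "symbol g z = f (symbol a z)" if z: "z \<in> sphere 0 1" for z
  proof -
    have z1: "norm z = 1" using z by simp
    have one: "symbol a z * symbol b z = 1"
      using symbol_conv[OF aw bw z1] by (simp add: ab symbol_delta0)
    then have inv: "symbol b z = inverse (symbol a z)"
      by (metis inverse_unique)
    have sd: "symbol (d i) z = symbol a z powi i" for i
      using symbol_conv_power[OF aw z1] symbol_conv_power[OF bw z1]
      by (simp add: d_def power_int_def inv)
    have dw: "d i \<in> wiener" for i using d[of i] by (simp add: wiener1_def)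
    have n: "norm (c i) * wiener_norm (d i) \<le> norm (c i) * B i" for i
    proof (rule mult_left_mono)
      have "wiener_norm (d i) \<le> wl1_norm wder (d i)"
        using wder.wl1_subset_wiener(2) d[of i] by (simp add: wiener1_wl1 wiener_wl1)
      also have "\<dots> \<le> B i" using D(3)[of i] Fnorm_nonneg[of "D i"] by linarith
      finally show "wiener_norm (d i) \<le> B i" .
    qed simp
    have "(\<lambda>i. norm (c i) * wiener_norm (d i)) summable_on UNIV"
      by (rule summable_on_comparison_test[OF cB]) (use n wiener_norm_nonneg in auto)
    from symbol_series[of d c, OF dw this z1] have "symbol g z = (\<Sum>\<^sub>\<infinity>i. c i * symbol a z powi i)"
      by (simp add: g_def sd)
    also have "symbol a z \<in> annulus r R" using assms(7) z by blast
    then have "(\<Sum>\<^sub>\<infinity>i. c i * symbol a z powi i) = f (symbol a z)"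
      using assms(3) unfolding analytic_laurent_def by (blast intro: infsumI)
    finally show ?thesis .
  qed
  have "smat_add (toeplitz g) E \<in> AQT" if AQT: "A \<in> AQT"
  proof -
    from AQT obtain a' E' h r' R' where a': "A = smat_add (toeplitz a') E'" "E' \<in> Fset"
      "0 \<le> r'" "r' < 1" "1 < R'" "analytic_laurent h a' r' R'"
      unfolding AQT_def by blast
    \<comment> \<open>The analytic representation may a priori have another symbol; uniqueness of
      the decomposition transfers the decay to \<open>a\<close>.\<close>
    have "a' = a" using toeplitz_add_unique(1)[of a' E' a Ea] a' a by simp
    then obtain \<rho> where \<rho>: "1 < \<rho>" "a \<in> wl1 (wpow \<rho>)"
      using analytic_laurent_imp_wl1[OF a'(6) a'(3-5)] by metis
    obtain \<rho>' where \<rho>': "1 < \<rho>'" "b \<in> wl1 (wpow \<rho>')"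
      using wl1_wpow_inverse[OF \<rho>(2,1) bw ab ba] by metis
    \<comment> \<open>\<open>K\<close> and \<open>L\<close> use the strictness of the norm
      hypotheses: they leave room for the norms at a radius slightly above 1, which may exceed the
      Wiener norms.\<close>
    obtain K where K: "ereal t < ereal K" "ereal K < R"
      using ereal_dense2 assms(10) unfolding t_def by blast
    obtain L where L: "ereal s < ereal L" "ereal L < inverse r"
      using ereal_dense2 assms(9) unfolding s_def by blast
    have "wiener_norm a < K"
      using wder.wl1_subset_wiener(2)[of a] a(1) at K(1) by (simp add: wiener1_wl1 wiener_wl1)
    then obtain \<sigma> where \<sigma>: "1 < \<sigma>" "\<sigma> \<le> \<rho>" "wl1_norm (wpow \<sigma>) a < K"
      using wl1_wpow_near_one[OF \<rho>(2,1)] by metis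
    have "wiener_norm b < L"
      using wder.wl1_subset_wiener(2)[of b] b(1) bs L(1) by (simp add: wiener1_wl1 wiener_wl1)
    then obtain \<sigma>' where \<sigma>': "1 < \<sigma>'" "\<sigma>' \<le> \<rho>'" "wl1_norm (wpow \<sigma>') b < L"
      using wl1_wpow_near_one[OF \<rho>'(2,1)] by metis
    \<comment> \<open>A common radius at which the norms of \<open>a\<close> and \<open>b\<close>
      both stay below their limits.\<close>
    define \<tau> where "\<tau> = min \<sigma> \<sigma>'"
    have \<tau>: "1 < \<tau>" "\<tau> \<le> \<sigma>" "\<tau> \<le> \<sigma>'" using \<sigma> \<sigma>' by (auto simp: \<tau>_def)
    interpret T: weight "wpow \<tau>" by (rule weight_power) (use \<tau> in simp)
    have a\<tau>: "a \<in> wl1 (wpow \<tau>)" "wl1_norm (wpow \<tau>) a < K"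
      using wl1_wpow_mono[OF \<rho>(2), of \<sigma>] wl1_wpow_mono[of a \<sigma> \<tau>] \<sigma> \<tau> by auto
    have b\<tau>: "b \<in> wl1 (wpow \<tau>)" "wl1_norm (wpow \<tau>) b < L"
      using wl1_wpow_mono[OF \<rho>'(2), of \<sigma>'] wl1_wpow_mono[of b \<sigma>' \<tau>] \<sigma>' \<tau> by auto
    define t' s' where "t' = wl1_norm (wpow \<tau>) a" and "s' = wl1_norm (wpow \<tau>) b"
    define B' where "B' = (\<lambda>i. if 0 \<le> i then t' ^ nat i else s' ^ nat (- i))"
    have "0 \<le> t'" "0 \<le> s'" unfolding t'_def s'_def by (rule wl1_norm_nonneg, rule T.nonneg)+
    moreover have "ereal t' < R" "ereal s' < inverse r"
      using less_trans[of "ereal t'" "ereal K" R] less_trans[of "ereal s'" "ereal L" "inverse r"] K L a\<tau> b\<tau>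
      by (simp_all add: t'_def s'_def)
    ultimately have cB': "(\<lambda>i. norm (c i) * B' i) summable_on UNIV"
      unfolding B'_def using assms by (intro laurent_coeff_summable)
    have "d i \<in> wl1 (wpow \<tau>) \<and> wl1_norm (wpow \<tau>) (d i) \<le> B' i" for i
      unfolding d_def B'_def t'_def s'_def
      using T.wl1_conv_power[OF a\<tau>(1)] T.wl1_conv_power[OF b\<tau>(1)] by auto
    then have "(\<lambda>j. c i * d i j) \<in> wl1 (wpow \<tau>)"
      "wl1_norm (wpow \<tau>) (\<lambda>j. c i * d i j) \<le> norm (c i) * B' i" for i
      using wl1_cmult[of "d i" "wpow \<tau>" "c i"] by (auto intro: mult_left_mono)
    \<comment> \<open>The same coefficient family \<open>g\<close>, now summed in the stronger norm;
      the correction \<open>E\<close> is kept.\<close>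
    from wl1_family(1)[OF T.nonneg this cB'] have "g \<in> wl1 (wpow \<tau>)"
      by (simp add: g_def)
    from analytic_laurent_symbol[OF this \<tau>(1)]
    have "analytic_laurent (symbol g) g (ereal (1 / \<tau>)) (ereal \<tau>)" .
    moreover have "0 \<le> ereal (1 / \<tau>)" "ereal (1 / \<tau>) < 1" "1 < ereal \<tau>" using \<tau>(1) by auto
    ultimately show ?thesis
      unfolding AQT_def using ser(2) by blast
  qed
  with conv ser(1,2) sym show ?thesis by blast
qed

end
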